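(* Consider the symmetric V-cycle multigrid algorithm on the uniformly refined spaces $V_0\subset\dots\subset V_J$, with smoothing error operators $S_k=\widehat E^s_{p_k}$ given by the symmetric successive subspace correction (SSC) algorithm with the subspaces $V_k^i$ and exact subsolvers $R_k^i$ (all defined in the context). If $m_k$ is non-increasing in $k$ ($k=1,\dots,J$), the multigrid algorithm converges with $$\gamma_k=\frac{C_0(3+2g_0)^2}{C_0(3+2g_0)^2+2m_k},\qquad k=1,\dots,J,$$ that is, $a(E_Jv,v)\le\gamma_J\,a(v,v)$ for all $v\in V_J$. Moreover, if $m_1=m_2=\dots=m_J$, the error bound is optimal, in the sense that $\gamma_J$ does not deteriorate as the number of multigrid spaces $J$ increases.
   Context: Model problem. $\Omega\subset\mathbb R^n$ is polygonal, $\Theta=(\theta_{ij})$ is a symmetric matrix, $(\cdot,\cdot)$ is the $L^2(\Omega)$ inner product, and $a(u,v)=\sum_{i,j=1}^n\int_\Omega\theta_{ij}\,\partial_{x_j}u\,\partial_{x_i}v\,dx$. There are constants $C_{\Theta,1},C_{\Theta,2}>0$ depending on $\Theta$ with $C_{\Theta,1}\|u\|_{H^1}^2\le a(u,u)\le C_{\Theta,2}\|u\|_{H^1}^2$ for $u\in V_k\subset H_0^1(\Omega)$. Triangulations. $\mathcal T_0$ is a quasi-uniform coarse triangulation of $\Omega$ of size $h_0\in(0,1]$, and $\mathcal T_k$ is obtained from $\mathcal T_{k-1}$ by midpoint refinement, so it has size $h_k=2^{-k}h_0$. $V_k=\{v\in H_0^1(\Omega): v|_\tau\in\mathcal P_1\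 \forall\tau\in\mathcal T_k\}$ is the space of continuous piecewise linear functions ($\mathcal P_1$ = linear polynomials), $k=0,\dots,J$. Subdomains. For each $k$, $\{\Omega_k^i\}_{i=1}^{p_k}$ are non-overlapping open subdomains of $\Omega$ whose boundaries align with $\mathcal T_k$, with $\overline\Omega=\bigcup_{i=1}^{p_k}\overline{\Omega_k^i}$. The overlapping subdomains are $\widehat\Omega_k^i=\{x\in\Omega:\mathrm{dist}(x,\Omega_k^i)\le h_0\}$, whose boundaries are also assumed to align with $\mathcal T_k$. Subspaces and subsolvers. $V_k^0=V_0$, $V_k^i=\{v\in V_k:\mathrm{supp}(v)\subseteq\widehat\Omega_k^i\}$ for $i=1,\dots,p_k$, and $R_k^i=(A_k^i)^{-1}$. Here $A_k:V_k\to V_k$ is defined by $(A_ku,v)=a(u,v)$, $A_k^i:V_k^i\to V_k^i$ by $(A_k^iu,v)=(A_ku,v)$ for $u,v\in V_k^i$, and $Q_k^i:V_k\to V_k^i$ is the $(\cdot,\cdot)$-orthogonal projection. Smoother. $T_k^i=R_k^iQ_k^iA_k$ on $V_k$ and, for $k\ge1$, $$S_k=\widehat E^s_{p_k}=(I-T_k^{p_k})\cdots(I-T_k^1)(I-T_k^0)^2(I-T_k^1)\cdots(I-T_k^{p_k}).$$ Multigrid. $m_k\ge1$ is the integer number of pre-smoothing steps, and also of post-smoothing steps, at level $k$. $P_k:V_J\to V_k$ is the $a$-orthogonal projection. The multigrid error operators of the V-cycle (exact solve at level $0$) are $E_0=0$, $E_k=S_k^{m_k}[I-(I-E_{k-1})P_{k-1}]S_k^{m_k}$.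 Constants. $C_0$ is a constant independent of $h_0$, $h_k$ and $p_k$ such that every $v\in V_k$ has a decomposition $v=\sum_{i=0}^{p_k}v_i$, $v_i\in V_k^i$, with $\sum_{i=0}^{p_k}a(v_i,v_i)\le C_0\,a(v,v)$ (such a constant is known to exist). $g_0=\max_{i=1,\dots,p_k}\sum_{j=1}^{p_k}G_{ij}$, where $G_{ij}=1$ if $\widehat\Omega_k^i\cap\widehat\Omega_k^j\neq\emptyset$ and $G_{ij}=0$ otherwise. By standing assumption on the choice of subdomains this quantity is uniformly bounded, and $g_0$ denotes a bound independent of $k$. *)

theory Defs
  imports "HOL-Analysis.Analysis"
begin

section \<open>Sobolev spaces\<close>

definition l2_fun :: "(real^'n) set \<Rightarrow> (real^'n \<Rightarrow> real) \<Rightarrow> bool" where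
  "l2_fun \<Omega> u \<longleftrightarrow>
     set_borel_measurable lebesgue \<Omega> u \<and> set_integrable lebesgue \<Omega> (\<lambda>x. (u x)\<^sup>2)"

definition l2_inner :: "(real^'n) set \<Rightarrow> (real^'n \<Rightarrow> real) \<Rightarrow> (real^'n \<Rightarrow> real) \<Rightarrow> real" where
  "l2_inner \<Omega> u v = (LINT x:\<Omega>|lebesgue. u x * v x)"

definition partial :: "'n \<Rightarrow> (real^'n \<Rightarrow> real) \<Rightarrow> real^'n \<Rightarrow> real" where
  "partial i \<phi> x = frechet_derivative \<phi> (at x) (axis i 1)"

text \<open>Weak derivatives are tested with, and \<open>H\<^sub>0\<^sup>1\<close> is the closure of, the compactly supported
  \<open>C\<^sup>1\<close> functions (the convention of Gilbarg and Trudinger). Using \<open>C\<^sup>\<infinity>\<close> functions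
  gives the same spaces.\<close>

definition test_functions :: "(real^'n) set \<Rightarrow> (real^'n \<Rightarrow> real) set" where
  "test_functions \<Omega> = {\<phi>. (\<forall>x. \<phi> differentiable (at x)) \<and>
     (\<forall>i. continuous_on UNIV (partial i \<phi>)) \<and>
     compact (closure {x. \<phi> x \<noteq> 0}) \<and> closure {x. \<phi> x \<noteq> 0} \<subseteq> \<Omega>}"

definition has_weak_partial ::
  "(real^'n) set \<Rightarrow> 'n \<Rightarrow> (real^'n \<Rightarrow> real) \<Rightarrow> (real^'n \<Rightarrow> real) \<Rightarrow> bool" where
  "has_weak_partial \<Omega> i u g \<longleftrightarrow> l2_fun \<Omega> g \<and>
     (\<forall>\<phi>\<in>test_functions \<Omega>.
        (LINT x:\<Omega>|lebesgue. u x * partial i \<phi> x) = - (LINT x:\<Omega>|lebesgue. g x * \<phi> x))"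

text \<open>Weak derivatives are unique only up to null sets, so this picks a representative; it is
  only used under integrals.\<close>

definition weak_partial :: "(real^'n) set \<Rightarrow> 'n \<Rightarrow> (real^'n \<Rightarrow> real) \<Rightarrow> real^'n \<Rightarrow> real" where
  "weak_partial \<Omega> i u = (SOME g. has_weak_partial \<Omega> i u g)"

definition H1 :: "(real^'n) set \<Rightarrow> (real^'n \<Rightarrow> real) set" where
  "H1 \<Omega> = {u. l2_fun \<Omega> u \<and> (\<forall>i. \<exists>g. has_weak_partial \<Omega> i u g)}"

definition h1_norm :: "(real^'n::finite) set \<Rightarrow> (real^'n \<Rightarrow> real) \<Rightarrow> real" where
  "h1_norm \<Omega> u = sqrt (l2_inner \<Omega> u u +
     (\<Sum>i\<in>UNIV. l2_inner \<Omega> (weak_partial \<Omega> i u) (weak_partial \<Omega> i u)))"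

definition H10 :: "(real^'n::finite) set \<Rightarrow> (real^'n \<Rightarrow> real) set" where
  "H10 \<Omega> = {u \<in> H1 \<Omega>. \<forall>\<epsilon>>0. \<exists>\<phi>\<in>test_functions \<Omega>. h1_norm \<Omega> (\<lambda>x. u x - \<phi> x) < \<epsilon>}"

definition energy ::
  "real^'n^'n::finite \<Rightarrow> (real^'n) set \<Rightarrow> (real^'n \<Rightarrow> real) \<Rightarrow> (real^'n \<Rightarrow> real) \<Rightarrow> real" where
  "energy \<Theta> \<Omega> u v = (\<Sum>i\<in>UNIV. \<Sum>j\<in>UNIV.
     (LINT x:\<Omega>|lebesgue. \<Theta> $ i $ j * weak_partial \<Omega> j u x * weak_partial \<Omega> i v x))"


section \<open>Triangulations and finite element spaces\<close>

definition polygonal_domain :: "(real^'n) set \<Rightarrow> bool" where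
  "polygonal_domain \<Omega> \<longleftrightarrow> \<Omega> \<noteq> {} \<and>
     (\<exists>\<P>. finite \<P> \<and> (\<forall>P\<in>\<P>. polytope P \<and> interior P \<noteq> {}) \<and> \<Omega> = interior (\<Union>\<P>))"

text \<open>The elements of a mesh are the closed simplices of full dimension; their lower-dimensional
  faces are not members.\<close>

definition mesh :: "(real^'n) set \<Rightarrow> (real^'n) set set \<Rightarrow> bool" where
  "mesh \<Omega> \<T> \<longleftrightarrow>
     triangulation \<T> \<and> (\<forall>\<tau>\<in>\<T>. int CARD('n) simplex \<tau>) \<and> \<Union>\<T> = closure \<Omega>"

definition quasi_uniform :: "real \<Rightarrow> real \<Rightarrow> (real^'n) set set \<Rightarrow> bool" where
  "quasi_uniform \<sigma> h \<T> \<longleftrightarrow>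
     0 < \<sigma> \<and> h = Max (diameter ` \<T>) \<and> (\<forall>\<tau>\<in>\<T>. \<exists>c. cball c (\<sigma> * h) \<subseteq> \<tau>)"

definition vertices :: "(real^'n) set \<Rightarrow> (real^'n) set" where
  "vertices \<tau> = {x. x extreme_point_of \<tau>}"

text \<open>Refining by edge midpoints: new vertices are midpoints of edges (or old vertices, when
  \<open>x = y\<close>), and the half-size simplex at every corner of an old element is a new element. When
  both are meshes of the same domain, this leaves in dimension 2 exactly the triangle joining the three midpoints, in dimension 3 an
  octahedron that is cut along one of its diagonals.\<close>

definition midpoint_refinement :: "(real^'n) set set \<Rightarrow> (real^'n) set set \<Rightarrow> bool" where
  "midpoint_refinement \<T> \<T>' \<longleftrightarrow>
     (\<forall>\<tau>'\<in>\<T>'. \<exists>\<tau>\<in>\<T>. \<tau>' \<subseteq> \<tau> \<and>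
        vertices \<tau>' \<subseteq> {midpoint x y | x y. x \<in> vertices \<tau> \<and> y \<in> vertices \<tau>}) \<and>
     (\<forall>\<tau>\<in>\<T>. \<forall>x\<in>vertices \<tau>. convex hull (midpoint x ` vertices \<tau>) \<in> \<T>')"

text \<open>Functions on \<open>\<Omega>\<close> are represented by their extension by zero. Requiring them to be affine
  on the closed elements, which cover \<open>\<Omega>\<close>, selects the continuous representative of the class
  in \<open>H\<^sub>0\<^sup>1(\<Omega>)\<close>.\<close>

definition fem_space :: "(real^'n::finite) set \<Rightarrow> (real^'n) set set \<Rightarrow> (real^'n \<Rightarrow> real) set" where
  "fem_space \<Omega> \<T> = {v \<in> H10 \<Omega>. (\<forall>x. x \<notin> \<Omega> \<longrightarrow> v x = 0) \<and>
     (\<forall>\<tau>\<in>\<T>. \<exists>c b. \<forall>x\<in>\<tau> \<inter> \<Omega>. v x = c \<bullet> x + b)}"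


section \<open>Subdomains and local spaces\<close>

definition aligned :: "(real^'n) set set \<Rightarrow> (real^'n) set \<Rightarrow> bool" where
  "aligned \<T> D \<longleftrightarrow> (\<forall>\<tau>\<in>\<T>. frontier D \<inter> interior \<tau> = {})"

definition overlap_region :: "(real^'n) set \<Rightarrow> real \<Rightarrow> (real^'n) set \<Rightarrow> (real^'n) set" where
  "overlap_region \<Omega> h D = {x\<in>\<Omega>. infdist x D \<le> h}"

definition subdomains ::
  "(real^'n) set \<Rightarrow> real \<Rightarrow> (real^'n) set set \<Rightarrow> nat \<Rightarrow> (nat \<Rightarrow> (real^'n) set) \<Rightarrow> bool" where
  "subdomains \<Omega> h \<T> p D \<longleftrightarrow>
     (\<forall>i\<in>{1..p}. open (D i) \<and> D i \<noteq> {} \<and> D i \<subseteq> \<Omega> \<and> aligned \<T> (D i) \<and>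
        aligned \<T> (overlap_region \<Omega> h (D i))) \<and>
     disjoint_family_on D {1..p} \<and>
     closure \<Omega> = (\<Union>i\<in>{1..p}. closure (D i))"

definition overlap_number :: "(real^'n) set \<Rightarrow> real \<Rightarrow> nat \<Rightarrow> (nat \<Rightarrow> (real^'n) set) \<Rightarrow> nat" where
  "overlap_number \<Omega> h p D = Max ((\<lambda>i. \<Sum>j=1..p.
     if overlap_region \<Omega> h (D i) \<inter> overlap_region \<Omega> h (D j) \<noteq> {} then 1 else 0) ` {1..p})"

text \<open>The support is closed relative to \<open>\<Omega>\<close>, so that functions supported up to \<open>\<partial>\<Omega>\<close> can have
  their support inside an overlapping subdomain, which is a subset of the open set \<open>\<Omega>\<close>.\<close>

definition supp_in :: "(real^'n) set \<Rightarrow> (real^'n \<Rightarrow> real) \<Rightarrow> (real^'n) set" where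
  "supp_in \<Omega> v = \<Omega> \<inter> closure {x\<in>\<Omega>. v x \<noteq> 0}"

definition local_space :: "(real^'n::finite) set \<Rightarrow> real \<Rightarrow> (nat \<Rightarrow> (real^'n) set set) \<Rightarrow>
    (nat \<Rightarrow> nat \<Rightarrow> (real^'n) set) \<Rightarrow> nat \<Rightarrow> nat \<Rightarrow> (real^'n \<Rightarrow> real) set" where
  "local_space \<Omega> h \<T> D k i =
     (if i = 0 then fem_space \<Omega> (\<T> 0)
      else {v \<in> fem_space \<Omega> (\<T> k). supp_in \<Omega> v \<subseteq> overlap_region \<Omega> h (D k i)})"


section \<open>Subspace correction and multigrid\<close>

text \<open>The operators below act on functions \<open>'a \<Rightarrow> real\<close> and take the inner product \<open>ip\<close>, the
  bilinear form \<open>a\<close> and the spaces as parameters. All of \<open>A\<^sub>k\<close>, \<open>A\<^sub>k\<^sup>i\<close>, \<open>Q\<^sub>k\<^sup>i\<close> and \<open>P\<^sub>k\<close> are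
  defined by testing, which is what \<open>riesz\<close> expresses.\<close>

definition riesz :: "('f \<Rightarrow> 'f \<Rightarrow> real) \<Rightarrow> 'f set \<Rightarrow> ('f \<Rightarrow> real) \<Rightarrow> 'f" where
  "riesz b W l = (THE w. w \<in> W \<and> (\<forall>v\<in>W. b w v = l v))"

definition orth_proj :: "('f \<Rightarrow> 'f \<Rightarrow> real) \<Rightarrow> 'f set \<Rightarrow> 'f \<Rightarrow> 'f" where
  "orth_proj b W u = riesz b W (b u)"

definition form_op :: "('f \<Rightarrow> 'f \<Rightarrow> real) \<Rightarrow> ('f \<Rightarrow> 'f \<Rightarrow> real) \<Rightarrow> 'f set \<Rightarrow> 'f \<Rightarrow> 'f" where
  "form_op ip a V u = riesz ip V (a u)"

definition restricted_op :: "('f \<Rightarrow> 'f \<Rightarrow> real) \<Rightarrow> ('f \<Rightarrow> 'f) \<Rightarrow> 'f set \<Rightarrow> 'f \<Rightarrow> 'f" where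
  "restricted_op ip A W u = riesz ip W (ip (A u))"

definition correction_op ::
  "('f \<Rightarrow> 'f \<Rightarrow> real) \<Rightarrow> ('f \<Rightarrow> 'f \<Rightarrow> real) \<Rightarrow> 'f set \<Rightarrow> 'f set \<Rightarrow> 'f \<Rightarrow> 'f" where
  "correction_op ip a V W =
     (let A = form_op ip a V; R = inv_into W (restricted_op ip A W); Q = orth_proj ip W
      in R \<circ> Q \<circ> A)"

definition id_minus :: "(('a \<Rightarrow> real) \<Rightarrow> 'a \<Rightarrow> real) \<Rightarrow> ('a \<Rightarrow> real) \<Rightarrow> 'a \<Rightarrow> real" where
  "id_minus T v = (\<lambda>x. v x - T v x)"

text \<open>\<open>sweep_desc T p = (I - T p) \<dots> (I - T 1)\<close> and \<open>sweep_asc T p = (I - T 1) \<dots> (I - T p)\<close>.\<close>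

primrec sweep_desc ::
  "(nat \<Rightarrow> ('a \<Rightarrow> real) \<Rightarrow> 'a \<Rightarrow> real) \<Rightarrow> nat \<Rightarrow> ('a \<Rightarrow> real) \<Rightarrow> 'a \<Rightarrow> real" where
  "sweep_desc T 0 = id"
| "sweep_desc T (Suc i) = id_minus (T (Suc i)) \<circ> sweep_desc T i"

primrec sweep_asc ::
  "(nat \<Rightarrow> ('a \<Rightarrow> real) \<Rightarrow> 'a \<Rightarrow> real) \<Rightarrow> nat \<Rightarrow> ('a \<Rightarrow> real) \<Rightarrow> 'a \<Rightarrow> real" where
  "sweep_asc T 0 = id"
| "sweep_asc T (Suc i) = sweep_asc T i \<circ> id_minus (T (Suc i))"

definition symmetric_ssc ::
  "(nat \<Rightarrow> ('a \<Rightarrow> real) \<Rightarrow> 'a \<Rightarrow> real) \<Rightarrow> nat \<Rightarrow> ('a \<Rightarrow> real) \<Rightarrow> 'a \<Rightarrow> real" where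
  "symmetric_ssc T p = sweep_desc T p \<circ> (id_minus (T 0) ^^ 2) \<circ> sweep_asc T p"

primrec vcycle_error :: "(('a \<Rightarrow> real) \<Rightarrow> ('a \<Rightarrow> real) \<Rightarrow> real) \<Rightarrow> (nat \<Rightarrow> ('a \<Rightarrow> real) set) \<Rightarrow>
    (nat \<Rightarrow> ('a \<Rightarrow> real) \<Rightarrow> 'a \<Rightarrow> real) \<Rightarrow> (nat \<Rightarrow> nat) \<Rightarrow> nat \<Rightarrow> ('a \<Rightarrow> real) \<Rightarrow> 'a \<Rightarrow> real" where
  "vcycle_error a V S m 0 = (\<lambda>v x. 0)"
| "vcycle_error a V S m (Suc k) =
     (S (Suc k) ^^ m (Suc k)) \<circ>
     id_minus (id_minus (vcycle_error a V S m k) \<circ> orth_proj a (V k)) \<circ>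
     (S (Suc k) ^^ m (Suc k))"

definition ssc_smoother :: "real^'n^'n::finite \<Rightarrow> (real^'n) set \<Rightarrow> real \<Rightarrow> (nat \<Rightarrow> (real^'n) set set) \<Rightarrow>
    (nat \<Rightarrow> nat) \<Rightarrow> (nat \<Rightarrow> nat \<Rightarrow> (real^'n) set) \<Rightarrow> nat \<Rightarrow> (real^'n \<Rightarrow> real) \<Rightarrow> real^'n \<Rightarrow> real" where
  "ssc_smoother \<Theta> \<Omega> h \<T> p D k =
     symmetric_ssc
       (\<lambda>i. correction_op (l2_inner \<Omega>) (energy \<Theta> \<Omega>) (fem_space \<Omega> (\<T> k)) (local_space \<Omega> h \<T> D k i))
       (p k)"

definition multigrid_error :: "real^'n^'n::finite \<Rightarrow> (real^'n) set \<Rightarrow> real \<Rightarrow>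
    (nat \<Rightarrow> (real^'n) set set) \<Rightarrow> (nat \<Rightarrow> nat) \<Rightarrow> (nat \<Rightarrow> nat \<Rightarrow> (real^'n) set) \<Rightarrow> (nat \<Rightarrow> nat) \<Rightarrow>
    nat \<Rightarrow> (real^'n \<Rightarrow> real) \<Rightarrow> real^'n \<Rightarrow> real" where
  "multigrid_error \<Theta> \<Omega> h \<T> p D m =
     vcycle_error (energy \<Theta> \<Omega>) (\<lambda>k. fem_space \<Omega> (\<T> k)) (ssc_smoother \<Theta> \<Omega> h \<T> p D) m"


section \<open>Standing assumptions\<close>

definition stable_decomposition ::
  "(('a \<Rightarrow> real) \<Rightarrow> ('a \<Rightarrow> real) \<Rightarrow> real) \<Rightarrow> ('a \<Rightarrow> real) set \<Rightarrow> (nat \<Rightarrow> ('a \<Rightarrow> real) set) \<Rightarrow> nat \<Rightarrow>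
    real \<Rightarrow> bool" where
  "stable_decomposition a V W p C \<longleftrightarrow>
     (\<forall>v\<in>V. \<exists>w. (\<forall>i\<le>p. w i \<in> W i) \<and> v = (\<lambda>x. \<Sum>i\<le>p. w i x) \<and>
        (\<Sum>i\<le>p. a (w i) (w i)) \<le> C * a v v)"

text \<open>\<open>multigrid_setting \<dots> J\<close> collects the assumptions on the levels \<open>0, \<dots>, J\<close>; the data of
  higher levels is irrelevant. The constants \<open>C\<^sub>0\<close> and \<open>g\<^sub>0\<close> do not depend on the level.\<close>

definition multigrid_setting :: "real^'n^'n::finite \<Rightarrow> (real^'n) set \<Rightarrow> real \<Rightarrow> real \<Rightarrow>
    (nat \<Rightarrow> (real^'n) set set) \<Rightarrow> (nat \<Rightarrow> nat) \<Rightarrow> (nat \<Rightarrow> nat \<Rightarrow> (real^'n) set) \<Rightarrow> (nat \<Rightarrow> nat) \<Rightarrow>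
    real \<Rightarrow> real \<Rightarrow> real \<Rightarrow> real \<Rightarrow> nat \<Rightarrow> bool" where
  "multigrid_setting \<Theta> \<Omega> \<sigma> h0 \<T> p D m C\<Theta>1 C\<Theta>2 C0 g0 J \<longleftrightarrow>
     polygonal_domain \<Omega> \<and> transpose \<Theta> = \<Theta> \<and>
     0 < h0 \<and> h0 \<le> 1 \<and> quasi_uniform \<sigma> h0 (\<T> 0) \<and>
     (\<forall>k\<le>J. mesh \<Omega> (\<T> k)) \<and> (\<forall>k<J. midpoint_refinement (\<T> k) (\<T> (Suc k))) \<and>
     0 < C\<Theta>1 \<and> 0 < C\<Theta>2 \<and>
     (\<forall>k\<le>J. \<forall>u\<in>fem_space \<Omega> (\<T> k).
        C\<Theta>1 * (h1_norm \<Omega> u)\<^sup>2 \<le> energy \<Theta> \<Omega> u u \<and>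
        energy \<Theta> \<Omega> u u \<le> C\<Theta>2 * (h1_norm \<Omega> u)\<^sup>2) \<and>
     (\<forall>k\<in>{1..J}. subdomains \<Omega> h0 (\<T> k) (p k) (D k)) \<and>
     (\<forall>k\<in>{1..J}. 1 \<le> m k) \<and>
     0 < C0 \<and>
     (\<forall>k\<in>{1..J}. stable_decomposition (energy \<Theta> \<Omega>) (fem_space \<Omega> (\<T> k))
        (local_space \<Omega> h0 \<T> D k) (p k) C0) \<and>
     (\<forall>k\<in>{1..J}. real (overlap_number \<Omega> h0 (p k) (D k)) \<le> g0)"

definition mg_rate :: "real \<Rightarrow> real \<Rightarrow> nat \<Rightarrow> real" where
  "mg_rate C0 g0 m = C0 * (3 + 2 * g0)\<^sup>2 / (C0 * (3 + 2 * g0)\<^sup>2 + 2 * real m)"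

end

theory Submission
  imports Defs "HOL-Library.Function_Algebras"
begin

text \<open>The exact local solver makes each \<open>T\<^sub>k\<^sup>i\<close> the energy-orthogonal projection onto \<open>V\<^sub>k\<^sup>i\<close>, so
  the smoother is \<open>S = K\<^sup>* K\<close> with \<open>K = (I - P\<^sub>0) (I - P\<^sub>1) \<dots> (I - P\<^sub>p)\<close>. The stable decomposition
  and the bounded overlap give \<open>a(v, v) \<le> C (a(v, v) - a(K v, K v))\<close> with \<open>C = C\<^sub>0 (3 + 2 g\<^sub>0)\<^sup>2\<close>: the
  coarse space meets the sum of the local corrections, whose energy is at most \<open>g\<^sub>0\<close> times the sum
  of their energies, and the local spaces meet each other only where they overlap. Hence \<open>S\<close>
  contracts the energy norm by \<open>1 - 1 / C\<close>. The coarse correction does not increase the energy,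
  so \<open>a(E\<^sub>k v, v) \<le> (1 - 1 / C)\<^bsup>2 m\<^sub>k\<^esup> a(v, v)\<close>, and Bernoulli's inequality bounds the factor by
  \<open>C / (C + 2 m\<^sub>k)\<close>. The coarse space in every smoother is what removes the need for
  elliptic regularity.\<close>

section \<open>Inner product spaces of functions\<close>

text \<open>The definitions select representatives: \<open>weak_partial\<close> is a
  \<open>SOME\<close> and \<open>riesz\<close> a \<open>THE\<close>. So bilinearity of
  \<open>energy\<close> is itself a theorem, resting on uniqueness of weak derivatives up to null
  sets. The fundamental lemma behind it, applied where a function vanishes, also makes functions
  with disjoint supports orthogonal, and this is how geometry reaches the overlap count. Projections
  exist by finite dimension and are unique by definiteness.

  The sweep estimate gives \<open>C0 * (1 + sqrt g0 + g0)\<^sup>2\<close>: 1 from the coarse space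
  against its own residual, \<open>sqrt g0\<close> from the coarse space against the sum of local
  corrections, \<open>g0\<close> from local spaces against local corrections. This is rounded up to
  \<open>C0 * (3 + 2 * g0)\<^sup>2\<close>. The exponent \<open>2 * m\<close> arises because
  \<open>S\<close> is symmetric: the two smoothing blocks together measure the energy of
  \<open>S^m v\<close>, and energy is a squared norm. Between levels only
  \<open>a (E u) u \<le> a u u\<close> is passed on, so nothing accumulates.\<close>

abbreviation (input) fscale :: "real \<Rightarrow> ('a \<Rightarrow> real) \<Rightarrow> 'a \<Rightarrow> real" (infixr \<open>*\<^sub>F\<close> 75) where
  "c *\<^sub>F u \<equiv> (\<lambda>x. c * u x)"

definition fun_subspace :: "('a \<Rightarrow> real) set \<Rightarrow> bool" where
  "fun_subspace V \<longleftrightarrow>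
     0 \<in> V \<and> (\<forall>u\<in>V. \<forall>v\<in>V. u + v \<in> V) \<and> (\<forall>c. \<forall>u\<in>V. c *\<^sub>F u \<in> V)"

lemma fun_subspaceD:
  assumes "fun_subspace V"
  shows fun_subspace_0: "0 \<in> V"
    and fun_subspace_add: "u \<in> V \<Longrightarrow> v \<in> V \<Longrightarrow> u + v \<in> V"
    and fun_subspace_scale: "u \<in> V \<Longrightarrow> c *\<^sub>F u \<in> V"
  using assms unfolding fun_subspace_def by blast+

lemma fun_subspace_diff:
  assumes "fun_subspace V" "u \<in> V" "v \<in> V"
  shows "u - v \<in> V"
proof -
  have "u + (-1) *\<^sub>F v \<in> V"
    using assms by (intro fun_subspace_add fun_subspace_scale)
  moreover have "u + (-1) *\<^sub>F v = u - v" by auto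
  ultimately show ?thesis by simp
qed

lemma fun_subspace_sum:
  assumes "fun_subspace V" "\<And>i. i \<in> I \<Longrightarrow> f i \<in> V"
  shows "sum f I \<in> V"
  using assms(2) by (induction I rule: infinite_finite_induct)
    (auto intro: fun_subspaceD[OF assms(1)])

lemma sum_fun_eq: "(\<lambda>x. \<Sum>i\<in>I. f i x) = sum f I" for f :: "'i \<Rightarrow> 'a \<Rightarrow> real"
  by (induction I rule: infinite_finite_induct) (auto simp: fun_eq_iff)

text \<open>Finite dimension is expressed by a finite set of points that determines the elements
  of \<open>V\<close>.\<close>

locale inner_product_space =
  fixes V :: "('a \<Rightarrow> real) set" and b :: "('a \<Rightarrow> real) \<Rightarrow> ('a \<Rightarrow> real) \<Rightarrow> real"
  assumes subspace: "fun_subspace V"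
    and finite_points: "\<exists>X. finite X \<and> (\<forall>v\<in>V. (\<forall>x\<in>X. v x = 0) \<longrightarrow> v = 0)"
    and sym: "u \<in> V \<Longrightarrow> v \<in> V \<Longrightarrow> b u v = b v u"
    and add_left: "u \<in> V \<Longrightarrow> v \<in> V \<Longrightarrow> w \<in> V \<Longrightarrow> b (u + v) w = b u w + b v w"
    and scale_left: "u \<in> V \<Longrightarrow> w \<in> V \<Longrightarrow> b (c *\<^sub>F u) w = c * b u w"
    and pos: "u \<in> V \<Longrightarrow> u \<noteq> 0 \<Longrightarrow> 0 < b u u"
begin

lemmas zero_mem = fun_subspace_0[OF subspace]
  and add_mem = fun_subspace_add[OF subspace]
  and scale_mem = fun_subspace_scale[OF subspace]
  and diff_mem = fun_subspace_diff[OF subspace]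
  and sum_mem = fun_subspace_sum[OF subspace]

lemma restrict: "fun_subspace W \<Longrightarrow> W \<subseteq> V \<Longrightarrow> inner_product_space W b"
  using finite_points by unfold_locales (auto simp: subset_iff sym add_left scale_left pos)

lemma add_right: "u \<in> V \<Longrightarrow> v \<in> V \<Longrightarrow> w \<in> V \<Longrightarrow> b w (u + v) = b w u + b w v"
  using add_left sym add_mem by metis

lemma scale_right: "u \<in> V \<Longrightarrow> w \<in> V \<Longrightarrow> b w (c *\<^sub>F u) = c * b w u"
  using scale_left sym scale_mem by metis

lemma diff_left: "u \<in> V \<Longrightarrow> v \<in> V \<Longrightarrow> w \<in> V \<Longrightarrow> b (u - v) w = b u w - b v w"
  using add_left[of "u - v" v w] diff_mem[of u v] by simp

lemma diff_right: "u \<in> V \<Longrightarrow> v \<in> V \<Longrightarrow> w \<in> V \<Longrightarrow> b w (u - v) = b w u - b w v"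
  using diff_left sym diff_mem by metis

lemma zero_left: "w \<in> V \<Longrightarrow> b 0 w = 0"
  using diff_left[of 0 0 w] zero_mem by simp

lemma zero_right: "w \<in> V \<Longrightarrow> b w 0 = 0"
  using zero_left sym zero_mem by metis

lemma nonneg: "u \<in> V \<Longrightarrow> 0 \<le> b u u"
  using pos[of u] zero_left[OF zero_mem] by (cases "u = 0") auto

lemma sum_left: "(\<And>i. i \<in> I \<Longrightarrow> f i \<in> V) \<Longrightarrow> w \<in> V \<Longrightarrow> b (sum f I) w = (\<Sum>i\<in>I. b (f i) w)"
  by (induction I rule: infinite_finite_induct) (auto simp: zero_left add_left sum_mem)

lemma sum_right: "(\<And>i. i \<in> I \<Longrightarrow> f i \<in> V) \<Longrightarrow> w \<in> V \<Longrightarrow> b w (sum f I) = (\<Sum>i\<in>I. b w (f i))"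
  using sum_left[of I f w] sym[of w] sum_mem[of I f] by simp

lemma cauchy_schwarz:
  assumes "u \<in> V" "v \<in> V"
  shows "\<bar>b u v\<bar> \<le> sqrt (b u u) * sqrt (b v v)"
proof (cases "v = 0")
  case False
  have pv: "0 < b v v" using pos assms(2) False by blast
  let ?t = "b u v / b v v"
  have m: "?t *\<^sub>F v \<in> V" "u - ?t *\<^sub>F v \<in> V" using assms scale_mem diff_mem by blast+
  have "0 \<le> b (u - ?t *\<^sub>F v) (u - ?t *\<^sub>F v)"
    by (rule nonneg) fact
  also have "\<dots> = b u u - ?t * b v u - ?t * (b u v - ?t * b v v)"
    using m assms by (simp only: diff_left diff_right scale_left scale_right)
  also have "\<dots> = b u u - (b u v)\<^sup>2 / b v v"
    using pv sym[OF assms] by (simp add: field_simps power2_eq_square)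
  finally have "(b u v)\<^sup>2 \<le> b u u * b v v" using pv by (simp add: field_simps)
  then show ?thesis
    by (metis real_sqrt_abs real_sqrt_le_mono real_sqrt_mult)
qed (use assms zero_right in simp)

lemma eqI:
  assumes "u \<in> V" "v \<in> V" "\<And>w. w \<in> V \<Longrightarrow> b u w = b v w"
  shows "u = v"
proof (rule ccontr)
  assume "u \<noteq> v"
  with pos[of "u - v"] diff_left[of u v "u - v"] assms diff_mem[of u v] show False by auto
qed

end

section \<open>Riesz representation and orthogonal projections in finite dimension\<close>

definition linear_form :: "('a \<Rightarrow> real) set \<Rightarrow> (('a \<Rightarrow> real) \<Rightarrow> real) \<Rightarrow> bool" where
  "linear_form V l \<longleftrightarrow> (\<forall>u\<in>V. \<forall>v\<in>V. l (u + v) = l u + l v) \<and> (\<forall>c. \<forall>u\<in>V. l (c *\<^sub>F u) = c * l u)"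

text \<open>Induction on the number of determining points: the kernel of one evaluation functional is
  either everything or a hyperplane.\<close>

lemma riesz_exists:
  assumes "inner_product_space V b" "linear_form V l"
  shows "\<exists>w\<in>V. \<forall>v\<in>V. b w v = l v"
proof -
  obtain X where "finite X" "\<forall>v\<in>V. (\<forall>x\<in>X. v x = 0) \<longrightarrow> v = 0"
    using inner_product_space.finite_points[OF assms(1)] by auto
  then show ?thesis using assms
  proof (induction X arbitrary: V l rule: finite_induct)
    case empty
    interpret inner_product_space V b by fact
    have "v = 0" if "v \<in> V" for v using empty that by blast
    moreover have "l 0 = 0"
    proof -
      have "0 *\<^sub>F 0 = (0 :: 'a \<Rightarrow> real)" by auto
      moreover have "l (0 *\<^sub>F 0) = 0 * l 0"
        using empty zero_mem unfolding linear_form_def by blast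
      ultimately show ?thesis by simp
    qed
    ultimately show ?case using zero_mem zero_left by metis
  next
    case (insert y X)
    interpret inner_product_space V b by fact
    \<comment> \<open>The kernel of evaluation at \<open>y\<close>. On it the remaining points
      \<open>X\<close> already determine a function, so the induction hypothesis represents every
      linear form on \<open>U\<close>.\<close>
    define U where "U = {v\<in>V. v y = 0}"
    have U: "fun_subspace U" "U \<subseteq> V"
      unfolding fun_subspace_def U_def using zero_mem add_mem scale_mem by auto
    interpret U: inner_product_space U b by (rule restrict[OF U])
    have rep: "\<exists>w\<in>U. \<forall>v\<in>U. b w v = k v" if "linear_form U k" for k
      using insert.IH[of U k] insert.prems(1) that U.inner_product_space_axioms
      unfolding U_def by blast
    have lU: "linear_form U l" using insert.prems(3) U unfolding linear_form_def by blast
    then obtain w0 where w0: "w0 \<in> U" "\<forall>v\<in>U. b w0 v = l v" using rep by blast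
    show ?case
    proof (cases "\<forall>v\<in>V. v y = 0")
      case True
      then have "U = V" unfolding U_def by blast
      then show ?thesis using w0 by blast
    next
      case False
      then obtain u where u: "u \<in> V" "u y \<noteq> 0" by blast
      have "linear_form U (b u)"
        unfolding linear_form_def using U u by (auto simp: subset_iff add_right scale_right)
      then obtain u0 where u0: "u0 \<in> U" "\<forall>v\<in>U. b u0 v = b u v" using rep by blast
      \<comment> \<open>Subtracting the representative of \<open>b u\<close> on \<open>U\<close>
        makes \<open>n\<close> orthogonal to \<open>U\<close>; as \<open>n y\<close> is nonzero,
        \<open>n\<close> spans the complement.\<close>
      define n where "n = u - u0"
      have n: "n \<in> V" "n y \<noteq> 0" using u u0 diff_mem unfolding n_def U_def by auto
      have nperp: "b n v = 0" if "v \<in> U" for v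
        using that u u0 U diff_left[of u u0 v] unfolding n_def by auto
      have npos: "0 < b n n" using n by (intro pos) auto
      \<comment> \<open>\<open>w0\<close> handles \<open>U\<close>; the multiple of \<open>n\<close>
        is fitted so that \<open>b w n = l n\<close>, using \<open>b w0 n = 0\<close>.\<close>
      define w where "w = w0 + (l n / b n n) *\<^sub>F n"
      have w0V: "w0 \<in> V" using w0 U by blast
      have wV: "w \<in> V" unfolding w_def using w0V n add_mem scale_mem by blast
      have "b w v = l v" if v: "v \<in> V" for v
      proof -
        define c where "c = v y / n y"
        define r where "r = v - c *\<^sub>F n"
        have cn: "c *\<^sub>F n \<in> V" using n scale_mem by blast
        have r: "r \<in> U" unfolding r_def U_def c_def using v n diff_mem[OF v cn] by (auto simp: c_def)
        then have rV: "r \<in> V" using U by blast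
        have dec: "v = r + c *\<^sub>F n" unfolding r_def by simp
        have w0n: "b w0 n = 0" using nperp[OF w0(1)] sym w0V n by metis
        have sc: "(l n / b n n) *\<^sub>F n \<in> V" using n scale_mem by blast
        have "b w v = b w r + c * b w n"
          unfolding dec using wV rV cn n by (simp only: add_right scale_right)
        also have "b w r = l r"
          unfolding w_def
          by (simp only: add_left[OF w0V sc rV] scale_left[OF n(1) rV] nperp[OF r])
            (use w0 r in simp)
        also have "b w n = l n"
          unfolding w_def
          by (simp only: add_left[OF w0V sc n(1)] scale_left[OF n(1) n(1)] w0n)
            (use npos in simp)
        also have "l r + c * l n = l v"
          using insert.prems(3) rV cn n unfolding linear_form_def dec by simp
        finally show ?thesis .
      qed
      then show ?thesis using wV by blast
    qed
  qed
qed

context inner_product_space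
begin

text \<open>\<open>riesz\<close> is a \<open>THE\<close>-term: \<open>riesz_exists\<close> gives
  existence, and definiteness of \<open>b\<close>, through \<open>eqI\<close>, gives the uniqueness
  that lets it be unfolded.\<close>

lemma riesz_works:
  assumes "linear_form V l"
  shows riesz_mem: "riesz b V l \<in> V" and riesz_apply: "v \<in> V \<Longrightarrow> b (riesz b V l) v = l v"
proof -
  obtain w where w: "w \<in> V" "\<forall>v\<in>V. b w v = l v"
    using riesz_exists[OF inner_product_space_axioms assms] by blast
  have "riesz b V l = w"
    unfolding riesz_def using w by (intro the_equality) (auto intro!: eqI)
  then show "riesz b V l \<in> V" "v \<in> V \<Longrightarrow> b (riesz b V l) v = l v" using w by auto
qed

lemma linear_form_inner:
  assumes "W \<subseteq> V" "u \<in> V"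
  shows "linear_form W (b u)"
  unfolding linear_form_def using assms by (auto simp: subset_iff add_right scale_right)

lemma orth_proj_works:
  assumes "fun_subspace W" "W \<subseteq> V" "u \<in> V"
  shows orth_proj_mem: "orth_proj b W u \<in> W"
    and orth_proj_apply: "v \<in> W \<Longrightarrow> b (orth_proj b W u) v = b u v"
  using inner_product_space.riesz_works[OF restrict[OF assms(1,2)] linear_form_inner[OF assms(2,3)]]
  unfolding orth_proj_def by auto

end

text \<open>The auxiliary inner product cancels. For \<open>v\<close> in \<open>W\<close>, testing
  \<open>Q A u\<close> gives \<open>ip (A u) v = a u v\<close>, and testing \<open>AW w\<close>,
  with \<open>w\<close> the energy projection of \<open>u\<close>, gives
  \<open>a w v = a u v\<close> as well; so \<open>Q A u = AW w\<close>. As \<open>a\<close> is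
  definite, \<open>AW\<close> is injective and inverting it returns \<open>w\<close>.\<close>

lemma correction_op_eq_orth_proj:
  assumes "inner_product_space V ip" "inner_product_space V a" "fun_subspace W" "W \<subseteq> V" "u \<in> V"
  shows "correction_op ip a V W u = orth_proj a W u"
proof -
  interpret I: inner_product_space V ip by fact
  interpret E: inner_product_space V a by fact
  interpret IW: inner_product_space W ip using I.restrict assms by blast
  interpret EW: inner_product_space W a using E.restrict assms by blast
  define A where "A = form_op ip a V"
  have A: "A v \<in> V" "w \<in> V \<Longrightarrow> ip (A v) w = a v w" if "v \<in> V" for v w
    using I.riesz_works[OF E.linear_form_inner[OF order_refl that]]
    unfolding A_def form_op_def by auto
  define AW where "AW = restricted_op ip A W"
  have AW: "AW v \<in> W" "w \<in> W \<Longrightarrow> ip (AW v) w = a v w" if "v \<in> W" for v w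
    using IW.riesz_works[OF I.linear_form_inner[OF assms(4) A(1)]] that A assms(4)
    unfolding AW_def restricted_op_def by (auto simp: subset_iff)
  have inj: "inj_on AW W"
  proof (intro inj_onI EW.eqI)
    fix u v w assume "u \<in> W" "v \<in> W" "AW u = AW v" "w \<in> W"
    then show "a u w = a v w" using AW(2)[of u w] AW(2)[of v w] by simp
  qed
  define w where "w = orth_proj a W u"
  have w: "w \<in> W" "\<And>v. v \<in> W \<Longrightarrow> a w v = a u v"
    using E.orth_proj_works[OF assms(3-5)] unfolding w_def by auto
  have Q: "orth_proj ip W (A u) \<in> W" "v \<in> W \<Longrightarrow> ip (orth_proj ip W (A u)) v = ip (A u) v" for v
    using I.orth_proj_works[OF assms(3,4) A(1)[OF assms(5)]] by auto
  have "orth_proj ip W (A u) = AW w"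
    using Q AW(1)[OF w(1)] AW(2)[OF w(1)] w(2) A(2)[OF assms(5)] assms(4)
    by (intro IW.eqI) auto
  then have "correction_op ip a V W u = inv_into W AW (AW w)"
    unfolding correction_op_def A_def AW_def by (simp add: Let_def)
  also have "\<dots> = w" using inj w(1) by simp
  finally show ?thesis unfolding w_def .
qed

section \<open>Subspace correction\<close>

text \<open>Cauchy-Schwarz on the edge set \<open>?E\<close> of the graph \<open>G\<close>: each
  index is the first end of at most \<open>g\<close> edges and, by symmetry, the second end of at
  most \<open>g\<close>, so each factor contributes \<open>sqrt g\<close>. In other words, the norm
  of an adjacency matrix is at most the maximal degree.\<close>

lemma bounded_degree_form:
  fixes x y :: "nat \<Rightarrow> real"
  assumes "finite I" "0 \<le> g"
    and sym: "\<And>i j. i \<in> I \<Longrightarrow> j \<in> I \<Longrightarrow> G i j \<longleftrightarrow> G j i"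
    and deg: "\<And>i. i \<in> I \<Longrightarrow> real (card {j\<in>I. G i j}) \<le> g"
    and nonneg: "\<And>i. i \<in> I \<Longrightarrow> 0 \<le> x i" "\<And>i. i \<in> I \<Longrightarrow> 0 \<le> y i"
  shows "(\<Sum>i\<in>I. \<Sum>j\<in>{j\<in>I. G i j}. x i * y j) \<le> g * (L2_set x I * L2_set y I)"
proof -
  let ?E = "SIGMA i:I. {j\<in>I. G i j}"
  have row: "(\<Sum>(i, j)\<in>?E. (z i)\<^sup>2) \<le> g * (\<Sum>i\<in>I. (z i)\<^sup>2)" for z :: "nat \<Rightarrow> real"
  proof -
    have "(\<Sum>(i, j)\<in>?E. (z i)\<^sup>2) = (\<Sum>i\<in>I. real (card {j\<in>I. G i j}) * (z i)\<^sup>2)"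
      using assms(1) by (subst sum.Sigma[symmetric]) auto
    also have "\<dots> \<le> (\<Sum>i\<in>I. g * (z i)\<^sup>2)"
      by (intro sum_mono mult_right_mono deg) auto
    finally show ?thesis by (simp add: sum_distrib_left)
  qed
  have "(\<Sum>(i, j)\<in>?E. (y j)\<^sup>2) = (\<Sum>(i, j)\<in>?E. (y i)\<^sup>2)"
    by (rule sum.reindex_bij_witness[of _ "\<lambda>(i, j). (j, i)" "\<lambda>(i, j). (j, i)"]) (auto simp: sym)
  then have col: "(\<Sum>(i, j)\<in>?E. (y j)\<^sup>2) \<le> g * (\<Sum>i\<in>I. (y i)\<^sup>2)" using row[of y] by simp
  have "(\<Sum>i\<in>I. \<Sum>j\<in>{j\<in>I. G i j}. x i * y j) = (\<Sum>(i, j)\<in>?E. x i * y j)"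
    using assms(1) by (subst sum.Sigma) auto
  also have "\<dots> \<le> (\<Sum>e\<in>?E. \<bar>x (fst e)\<bar> * \<bar>y (snd e)\<bar>)"
    using nonneg by (intro sum_mono) (auto simp: abs_mult)
  also have "\<dots> \<le> L2_set (\<lambda>e. x (fst e)) ?E * L2_set (\<lambda>e. y (snd e)) ?E"
    by (rule L2_set_mult_ineq)
  also have "\<dots> \<le> (sqrt g * L2_set x I) * (sqrt g * L2_set y I)"
    using row[of x] col unfolding L2_set_def
    by (intro mult_mono) (auto simp: real_sqrt_mult[symmetric] case_prod_beta sum_nonneg assms(2))
  also have "\<dots> = g * (L2_set x I * L2_set y I)" using assms(2) by simp
  finally show ?thesis .
qed

lemma L2_set_sqrt_power2:
  assumes "\<And>i. i \<in> I \<Longrightarrow> 0 \<le> f i"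
  shows "(L2_set (\<lambda>i. sqrt (f i)) I)\<^sup>2 = sum f I"
proof -
  have "(\<Sum>i\<in>I. (sqrt (f i))\<^sup>2) = sum f I" using assms by (intro sum.cong) auto
  then show ?thesis unfolding L2_set_def using sum_nonneg[of I f, OF assms] by simp
qed

text \<open>Because \<open>(1 - 1 / C) * (1 + 1 / C) \<le> 1\<close>, the power of the first factor
  is at most the reciprocal of that of the second, which Bernoulli bounds below by
  \<open>1 + n / C\<close>. For \<open>C < 1\<close> the truncated base is 0, and
  \<open>n = 0\<close> gives 1 on both sides.\<close>

lemma max_power_bernoulli:
  fixes C :: real
  assumes "0 < C"
  shows "(max 0 (1 - 1 / C)) ^ n \<le> C / (C + real n)"
proof (cases "C < 1")
  case True
  then have "1 - 1 / C < 0" using assms by (simp add: field_simps)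
  then show ?thesis using assms by (cases n) auto
next
  case False
  then have r: "0 \<le> 1 - 1 / C" by simp
  have "((1 - 1 / C) * (1 + 1 / C)) ^ n \<le> 1"
    using r assms by (intro power_le_one mult_nonneg_nonneg) (auto simp: field_simps)
  moreover have "1 + real n * (1 / C) \<le> (1 + 1 / C) ^ n"
    using assms by (intro Bernoulli_inequality) (simp add: order_trans[of _ 0])
  ultimately have "(1 - 1 / C) ^ n * (1 + real n * (1 / C)) \<le> 1"
    using mult_left_mono[of "1 + real n * (1 / C)" "(1 + 1 / C) ^ n" "(1 - 1 / C) ^ n"] r
    by (simp only: power_mult_distrib zero_le_power) (meson order_trans)
  then show ?thesis using assms r by (simp add: field_simps add_pos_nonneg max_def)
qed

text \<open>\<open>G\<close> is an abstract overlap graph on the local indices \<open>1..p\<close>,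
  to be instantiated by intersecting overlap regions. Index 0, the coarse space, stays outside
  \<open>G\<close> because it may couple with every local space; it gets a separate Cauchy-Schwarz
  estimate.\<close>

locale subspace_correction = inner_product_space V a
  for V :: "('a \<Rightarrow> real) set" and a +
  fixes W :: "nat \<Rightarrow> ('a \<Rightarrow> real) set" and p :: nat and C g :: real
    and G :: "nat \<Rightarrow> nat \<Rightarrow> bool"
  assumes subspaces: "i \<le> p \<Longrightarrow> fun_subspace (W i)" "i \<le> p \<Longrightarrow> W i \<subseteq> V"
    and stable: "stable_decomposition a V W p C"
    and C_pos: "0 < C"
    and G_sym: "G i j \<longleftrightarrow> G j i"
    and G_orth: "i \<in> {1..p} \<Longrightarrow> j \<in> {1..p} \<Longrightarrow> \<not> G i j \<Longrightarrow> u \<in> W i \<Longrightarrow> v \<in> W j \<Longrightarrow> a u v = 0"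
    and G_degree: "i \<in> {1..p} \<Longrightarrow> real (card {j\<in>{1..p}. G i j}) \<le> g"
    and g_nonneg: "0 \<le> g"
begin

section \<open>Sweeps of energy projections and the energy that they remove\<close>

abbreviation P :: "nat \<Rightarrow> ('a \<Rightarrow> real) \<Rightarrow> 'a \<Rightarrow> real" where
  "P i \<equiv> orth_proj a (W i)"

lemma id_minus_apply: "id_minus T v = v - T v"
  unfolding id_minus_def by auto

lemma P_mem: "i \<le> p \<Longrightarrow> v \<in> V \<Longrightarrow> P i v \<in> W i"
  and P_apply: "i \<le> p \<Longrightarrow> v \<in> V \<Longrightarrow> w \<in> W i \<Longrightarrow> a (P i v) w = a v w"
  using orth_proj_works subspaces by blast+

lemma P_mem_V: "i \<le> p \<Longrightarrow> v \<in> V \<Longrightarrow> P i v \<in> V"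
  using P_mem subspaces by blast

lemma P_sym: "i \<le> p \<Longrightarrow> u \<in> V \<Longrightarrow> v \<in> V \<Longrightarrow> a (P i u) v = a u (P i v)"
  using P_apply[of i u "P i v"] P_apply[of i v "P i u"] sym[of "P i u" v] sym[of "P i v" "P i u"]
    sym[of u "P i v"] by (simp add: P_mem P_mem_V)

lemma id_minus_P_mem: "i \<le> p \<Longrightarrow> v \<in> V \<Longrightarrow> id_minus (P i) v \<in> V"
  by (simp add: id_minus_apply diff_mem P_mem_V)

lemma id_minus_P_sym:
  "i \<le> p \<Longrightarrow> u \<in> V \<Longrightarrow> v \<in> V \<Longrightarrow> a (id_minus (P i) u) v = a u (id_minus (P i) v)"
  by (simp add: id_minus_apply diff_left diff_right P_mem_V P_sym)

lemma pythagoras: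
  assumes "i \<le> p" "v \<in> V"
  shows "a v v - a (id_minus (P i) v) (id_minus (P i) v) = a (P i v) (P i v)"
proof -
  note m = assms(2) P_mem_V[OF assms] diff_mem[OF assms(2) P_mem_V[OF assms]]
  have "a v (P i v) = a (P i v) (P i v)"
    using P_apply[OF assms P_mem[OF assms]] by simp
  then show ?thesis
    using m sym[of "P i v" v] by (simp add: id_minus_apply diff_left diff_right)
qed

lemma sweep_mem:
  "n \<le> p \<Longrightarrow> v \<in> V \<Longrightarrow> sweep_asc P n v \<in> V" "n \<le> p \<Longrightarrow> v \<in> V \<Longrightarrow> sweep_desc P n v \<in> V"
  by (induction n arbitrary: v) (auto intro: id_minus_P_mem)

lemma sweep_adjoint:
  "n \<le> p \<Longrightarrow> u \<in> V \<Longrightarrow> v \<in> V \<Longrightarrow> a (sweep_desc P n u) v = a u (sweep_asc P n v)"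
  by (induction n arbitrary: u v) (auto simp: id_minus_P_mem id_minus_P_sym sweep_mem)

text \<open>\<open>half_sweep = (I - P\<^sub>0) (I - P\<^sub>1) \<dots> (I - P\<^sub>p)\<close>; the symmetric sweep is its composition
  with its adjoint.\<close>

definition half_sweep :: "('a \<Rightarrow> real) \<Rightarrow> 'a \<Rightarrow> real" where
  "half_sweep = id_minus (P 0) \<circ> sweep_asc P p"

definition half_sweep_adj :: "('a \<Rightarrow> real) \<Rightarrow> 'a \<Rightarrow> real" where
  "half_sweep_adj = sweep_desc P p \<circ> id_minus (P 0)"

lemma symmetric_ssc_eq: "symmetric_ssc P p v = half_sweep_adj (half_sweep v)"
  unfolding symmetric_ssc_def half_sweep_def half_sweep_adj_def by (simp add: numeral_2_eq_2)

lemma half_sweep_mem: "v \<in> V \<Longrightarrow> half_sweep v \<in> V" "v \<in> V \<Longrightarrow> half_sweep_adj v \<in> V"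
  unfolding half_sweep_def half_sweep_adj_def by (auto simp: id_minus_P_mem sweep_mem)

lemma half_sweep_adjoint: "u \<in> V \<Longrightarrow> v \<in> V \<Longrightarrow> a (half_sweep_adj u) v = a u (half_sweep v)"
  unfolding half_sweep_def half_sweep_adj_def
  by (simp add: id_minus_P_mem sweep_mem sweep_adjoint id_minus_P_sym)

text \<open>\<open>d i\<close> is the correction made in \<open>W i\<close>. The factor with the
  largest index acts first, so \<open>d i\<close> is the projection of \<open>v\<close> minus the
  corrections with index above \<open>i\<close>; hence the interval \<open>{i<..n}\<close>. The
  energy identity telescopes \<open>pythagoras\<close>.\<close>

lemma sweep_corrections:
  assumes "n \<le> p" "v \<in> V"
  shows "\<exists>d. (\<forall>i\<in>{1..n}. d i \<in> W i \<and> (\<forall>w\<in>W i. a (d i) w = a (v - sum d {i<..n}) w)) \<and>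
    sweep_asc P n v = v - sum d {1..n} \<and>
    a v v - a (sweep_asc P n v) (sweep_asc P n v) = (\<Sum>i\<in>{1..n}. a (d i) (d i))"
  using assms
proof (induction n arbitrary: v)
  case 0
  then show ?case by simp
next
  case (Suc n)
  define z where "z = P (Suc n) v"
  define v' where "v' = id_minus (P (Suc n)) v"
  have v'_eq: "v' = v - z" unfolding v'_def z_def by (rule id_minus_apply)
  have v'V: "v' \<in> V" unfolding v'_def using Suc.prems by (intro id_minus_P_mem)
  obtain d where d: "\<forall>i\<in>{1..n}. d i \<in> W i \<and> (\<forall>w\<in>W i. a (d i) w = a (v' - sum d {i<..n}) w)"
    "sweep_asc P n v' = v' - sum d {1..n}"
    "a v' v' - a (sweep_asc P n v') (sweep_asc P n v') = (\<Sum>i\<in>{1..n}. a (d i) (d i))"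
    using Suc.IH[OF Suc_leD[OF Suc.prems(1)] v'V] by blast
  \<comment> \<open>The factor split off by the induction acts first; its correction
    \<open>z\<close> joins those of the shorter sweep applied to \<open>v'\<close>.\<close>
  define e where "e = d(Suc n := z)"
  have e: "sum e {i<..n} = sum d {i<..n}" "sum e {1..n} = sum d {1..n}"
    "(\<Sum>i\<in>{1..n}. a (e i) (e i)) = (\<Sum>i\<in>{1..n}. a (d i) (d i))" for i
    unfolding e_def by (auto intro!: sum.cong)
  have eS: "e (Suc n) = z" unfolding e_def by simp
  have tail: "v - sum e {i<..Suc n} = v' - sum d {i<..n}" if "i \<le> n" for i
  proof -
    have "{i<..Suc n} = insert (Suc n) {i<..n}" using that by auto
    then have "sum e {i<..Suc n} = z + sum d {i<..n}" by (simp add: e eS)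
    then show ?thesis by (simp add: v'_eq algebra_simps)
  qed
  have "e i \<in> W i \<and> (\<forall>w\<in>W i. a (e i) w = a (v - sum e {i<..Suc n}) w)" if "i \<in> {1..Suc n}" for i
  proof (cases "i = Suc n")
    case True
    then show ?thesis using Suc.prems by (simp add: eS z_def P_mem P_apply)
  next
    case False
    then have "i \<in> {1..n}" "e i = d i" using that unfolding e_def by auto
    then show ?thesis using d(1) tail[of i] by auto
  qed
  moreover have "sweep_asc P (Suc n) v = v - sum e {1..Suc n}"
    using d(2) e(2) by (simp add: eS v'_def[symmetric]) (simp add: v'_eq algebra_simps)
  moreover have "a v v - a (sweep_asc P (Suc n) v) (sweep_asc P (Suc n) v)
      = (\<Sum>i\<in>{1..Suc n}. a (e i) (e i))"
    using d(3) pythagoras[OF Suc.prems] e(3)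
    by (simp add: eS v'_def[symmetric] z_def[symmetric])
  ultimately show ?case by blast
qed

text \<open>Expand \<open>a v v\<close> as the sum of \<open>a v (w i)\<close> over a stable
  decomposition. On \<open>W i\<close> the residual met by the sweep acts as the correction
  \<open>d i\<close>, so \<open>v\<close> is seen only through corrections. Their total energy
  \<open>T\<^sup>2\<close> is exactly the energy lost by the half sweep, that of the
  \<open>w i\<close> is at most \<open>C * a v v\<close>, and Cauchy-Schwarz couples the
  two.\<close>

lemma half_sweep_energy:
  assumes v: "v \<in> V"
  shows "a v v \<le> C * (1 + sqrt g + g)\<^sup>2 * (a v v - a (half_sweep v) (half_sweep v))"
proof -
  obtain d where d: "\<And>i. i \<in> {1..p} \<Longrightarrow> d i \<in> W i"
    "\<And>i w. i \<in> {1..p} \<Longrightarrow> w \<in> W i \<Longrightarrow> a (d i) w = a (v - sum d {i<..p}) w"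
    "sweep_asc P p v = v - sum d {1..p}"
    "a v v - a (sweep_asc P p v) (sweep_asc P p v) = (\<Sum>i\<in>{1..p}. a (d i) (d i))"
    using sweep_corrections[OF order_refl v] by blast
  obtain w where w: "\<And>i. i \<le> p \<Longrightarrow> w i \<in> W i" "v = (\<lambda>x. \<Sum>i\<le>p. w i x)"
    "(\<Sum>i\<le>p. a (w i) (w i)) \<le> C * a v v"
    using stable[unfolded stable_decomposition_def, rule_format, OF v] by blast
  have w_sum: "v = sum w {..p}" using w(2) by (simp only: sum_fun_eq)
  have wV: "w i \<in> V" if "i \<le> p" for i using w(1) subspaces that by blast
  have dV: "d i \<in> V" if "i \<in> {1..p}" for i using d(1) subspaces that by fastforce
  define s where "s = sweep_asc P p v"
  have sV: "s \<in> V" unfolding s_def using v by (simp add: sweep_mem)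
  define d0 where "d0 = P 0 s"
  have d0V: "d0 \<in> V" unfolding d0_def using sV by (simp add: P_mem_V)
  define D where "D = sum d {1..p}"
  have DV: "D \<in> V" unfolding D_def using dV by (rule sum_mem)
  let ?\<nu> = "\<lambda>i. sqrt (a (w i) (w i))" and ?\<delta> = "\<lambda>i. sqrt (a (d i) (d i))"
  define n0 where "n0 = ?\<nu> 0"
  define N where "N = L2_set ?\<nu> {1..p}"
  define \<delta>0 where "\<delta>0 = sqrt (a d0 d0)"
  define \<Delta> where "\<Delta> = L2_set ?\<delta> {1..p}"
  define T where "T = sqrt (\<delta>0\<^sup>2 + \<Delta>\<^sup>2)"
  define M where "M = sqrt (n0\<^sup>2 + N\<^sup>2)"
  have nn: "0 \<le> n0" "0 \<le> N" "0 \<le> \<delta>0" "0 \<le> \<Delta>" "0 \<le> T" "0 \<le> M"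
    unfolding n0_def N_def \<delta>0_def \<Delta>_def T_def M_def using nonneg[OF d0V] nonneg[OF wV[of 0]]
    by (auto simp: L2_set_nonneg)
  have T_ge: "\<delta>0 \<le> T" "\<Delta> \<le> T" and M_ge: "n0 \<le> M" "N \<le> M"
    unfolding T_def M_def by (auto intro!: real_le_rsqrt)
  have \<Delta>2: "\<Delta>\<^sup>2 = (\<Sum>i\<in>{1..p}. a (d i) (d i))"
    unfolding \<Delta>_def using dV nonneg by (intro L2_set_sqrt_power2) auto
  have N2: "N\<^sup>2 = (\<Sum>i\<in>{1..p}. a (w i) (w i))"
    unfolding N_def using wV nonneg by (intro L2_set_sqrt_power2) auto
  have dsum: "0 \<le> (\<Sum>i\<in>{1..p}. a (d i) (d i))" unfolding \<Delta>2[symmetric] by simp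
  have "M\<^sup>2 = (\<Sum>i\<le>p. a (w i) (w i))"
  proof -
    have "{..p} = insert 0 {1..p}" by auto
    moreover have "M\<^sup>2 = n0\<^sup>2 + N\<^sup>2" unfolding M_def by simp
    ultimately show ?thesis unfolding N2 n0_def using nonneg[OF wV[of 0]] by simp
  qed
  then have M_le: "M\<^sup>2 \<le> C * a v v" using w(3) by simp
  have T2: "T\<^sup>2 = a v v - a (half_sweep v) (half_sweep v)"
  proof -
    have "T\<^sup>2 = a d0 d0 + (a v v - a s s)"
      using d(4) nonneg[OF d0V] dsum unfolding T_def \<Delta>2 \<delta>0_def s_def by simp
    moreover have "a s s - a (half_sweep v) (half_sweep v) = a d0 d0"
      unfolding half_sweep_def d0_def using pythagoras[OF _ sV, of 0] by (simp add: s_def)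
    ultimately show ?thesis by simp
  qed
  \<comment> \<open>Local corrections without overlap are orthogonal, so this is
    \<open>bounded_degree_form\<close> with both vectors equal to the norms of the
    \<open>d i\<close>.\<close>
  have D_norm: "sqrt (a D D) \<le> sqrt g * \<Delta>"
  proof -
    have "a D D = (\<Sum>i\<in>{1..p}. a (d i) D)"
      using sum_left[of "{1..p}" d D, OF dV DV] by (simp only: D_def)
    also have "\<dots> = (\<Sum>i\<in>{1..p}. \<Sum>j\<in>{1..p}. a (d i) (d j))"
      using sum_right[of "{1..p}" d, OF dV dV] by (simp only: D_def cong: sum.cong)
    also have "\<dots> \<le> (\<Sum>i\<in>{1..p}. \<Sum>j\<in>{j\<in>{1..p}. G i j}. ?\<delta> i * ?\<delta> j)"
    proof (intro sum_mono)
      fix i assume i: "i \<in> {1..p}"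
      have "(\<Sum>j\<in>{1..p}. a (d i) (d j)) = (\<Sum>j\<in>{j\<in>{1..p}. G i j}. a (d i) (d j))"
      proof (rule sum.mono_neutral_right)
        show "\<forall>j\<in>{1..p} - {j\<in>{1..p}. G i j}. a (d i) (d j) = 0"
          using G_orth[OF i _ _ d(1)[OF i] d(1)] by blast
      qed auto
      also have "\<dots> \<le> (\<Sum>j\<in>{j\<in>{1..p}. G i j}. ?\<delta> i * ?\<delta> j)"
        using cauchy_schwarz dV i by (intro sum_mono) (auto dest!: abs_le_D1)
      finally show "(\<Sum>j\<in>{1..p}. a (d i) (d j)) \<le> \<dots>" .
    qed
    also have "\<dots> \<le> g * (\<Delta> * \<Delta>)"
      unfolding \<Delta>_def using G_sym G_degree g_nonneg dV nonneg
      by (intro bounded_degree_form) auto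
    finally have "sqrt (a D D) \<le> sqrt (g * (\<Delta> * \<Delta>))" by (rule real_sqrt_le_mono)
    then show ?thesis using nn by (simp add: real_sqrt_mult)
  qed
  \<comment> \<open>The coarse correction comes last: \<open>v\<close> is the final local residual
    \<open>s\<close> plus all local corrections, and on \<open>W 0\<close> the part \<open>s\<close>
    acts as \<open>d0\<close>.\<close>
  have term0: "a v (w 0) \<le> \<delta>0 * n0 + sqrt g * \<Delta> * n0"
  proof -
    have w0: "w 0 \<in> W 0" "w 0 \<in> V" using w(1) wV by auto
    have "v = s + D" using d(3) unfolding s_def D_def by simp
    then have "a v (w 0) = a s (w 0) + a D (w 0)" using sV DV w0 by (simp add: add_left)
    also have "a s (w 0) = a d0 (w 0)" unfolding d0_def using P_apply[OF _ sV w0(1)] by simp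
    also have "a d0 (w 0) \<le> \<delta>0 * n0"
      using cauchy_schwarz[OF d0V w0(2)] unfolding \<delta>0_def n0_def by linarith
    also have "a D (w 0) \<le> sqrt g * \<Delta> * n0"
      using cauchy_schwarz[OF DV w0(2)] mult_right_mono[OF D_norm nn(1)] unfolding n0_def by linarith
    finally show ?thesis by simp
  qed
  have termi: "(\<Sum>i\<in>{1..p}. a v (w i)) \<le> g * (N * \<Delta>)"
  proof -
    have "(\<Sum>i\<in>{1..p}. a v (w i)) \<le> (\<Sum>i\<in>{1..p}. \<Sum>j\<in>{j\<in>{1..p}. G i j}. ?\<nu> i * ?\<delta> j)"
    proof (rule sum_mono)
      fix i assume i: "i \<in> {1..p}"
      have wi: "w i \<in> W i" "w i \<in> V" using w(1) wV i by auto
      have t: "sum d {i<..p} \<in> V" using dV i by (intro sum_mem) auto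
      have "v = (v - sum d {i<..p}) + sum d {i<..p}" by simp
      then have "a v (w i) = a (v - sum d {i<..p}) (w i) + a (sum d {i<..p}) (w i)"
        using add_left[OF diff_mem[OF v t] t wi(2)] by simp
      also have "\<dots> = a (d i) (w i) + (\<Sum>j\<in>{i<..p}. a (d j) (w i))"
        using d(2)[OF i wi(1)] sum_left[of "{i<..p}" d, OF dV wi(2)] i by auto
      also have "\<dots> = (\<Sum>j\<in>{i..p}. a (d j) (w i))"
      proof -
        have "{i..p} = insert i {i<..p}" using i by auto
        then show ?thesis by simp
      qed
      also have "\<dots> = (\<Sum>j\<in>{j\<in>{i..p}. G i j}. a (d j) (w i))"
      proof (rule sum.mono_neutral_right)
        show "\<forall>j\<in>{i..p} - {j\<in>{i..p}. G i j}. a (d j) (w i) = 0"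
        proof
          fix j assume "j \<in> {i..p} - {j\<in>{i..p}. G i j}"
          then have "j \<in> {1..p}" "\<not> G j i" using i G_sym[of j i] by auto
          then show "a (d j) (w i) = 0" using i d(1) wi(1) by (intro G_orth)
        qed
      qed auto
      also have "\<dots> \<le> (\<Sum>j\<in>{j\<in>{i..p}. G i j}. ?\<nu> i * ?\<delta> j)"
      proof (rule sum_mono)
        fix j assume "j \<in> {j\<in>{i..p}. G i j}"
        then have "j \<in> {1..p}" using i by auto
        then show "a (d j) (w i) \<le> ?\<nu> i * ?\<delta> j"
          using cauchy_schwarz[OF dV wi(2), of j] by (simp add: mult.commute)
      qed
      \<comment> \<open>Only corrections from \<open>i\<close> upward occur; adding nonnegative
        terms with \<open>j < i\<close> completes the overlap graph, whose degrees are
        bounded.\<close>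
      also have "\<dots> \<le> (\<Sum>j\<in>{j\<in>{1..p}. G i j}. ?\<nu> i * ?\<delta> j)"
        using i dV nonneg wi by (intro sum_mono2) (auto intro!: mult_nonneg_nonneg)
      finally show "a v (w i) \<le> \<dots>" .
    qed
    also have "\<dots> \<le> g * (N * \<Delta>)"
      unfolding \<Delta>_def N_def using G_sym G_degree g_nonneg dV wV nonneg
      by (intro bounded_degree_form) auto
    finally show ?thesis .
  qed
  have "a v v = (\<Sum>i\<le>p. a v (w i))"
    using sum_right[of "{..p}" w v] wV v w_sum by auto
  also have "\<dots> = a v (w 0) + (\<Sum>i\<in>{1..p}. a v (w i))"
  proof -
    have "{..p} = insert 0 {1..p}" by auto
    then show ?thesis by simp
  qed
  also have "\<dots> \<le> \<delta>0 * n0 + sqrt g * \<Delta> * n0 + g * (N * \<Delta>)" using term0 termi by simp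
  \<comment> \<open>Each partial norm is at most the total \<open>T\<close> or \<open>M\<close>, so
    the three couplings contribute the factors 1, \<open>sqrt g\<close> and
    \<open>g\<close>.\<close>
  also have "\<dots> \<le> T * M + sqrt g * T * M + g * (M * T)"
    using T_ge M_ge nn g_nonneg by (intro add_mono mult_mono mult_left_mono) auto
  also have "\<dots> = (1 + sqrt g + g) * T * M" by (simp add: algebra_simps)
  finally have main: "a v v \<le> (1 + sqrt g + g) * T * M" .
  show ?thesis
  proof (cases "a v v = 0")
    case True
    have "0 \<le> C * (1 + sqrt g + g)\<^sup>2 * T\<^sup>2" using C_pos by simp
    then show ?thesis unfolding T2 using True by linarith
  next
    case False
    then have av: "0 < a v v" using nonneg[OF v] by simp
    \<comment> \<open>\<open>M\<^sup>2\<close> is bounded by a multiple of \<open>a v v\<close>, so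
      squaring allows one factor \<open>a v v\<close> to be cancelled.\<close>
    have "(a v v)\<^sup>2 \<le> ((1 + sqrt g + g) * T * M)\<^sup>2" using main av by (intro power_mono) auto
    also have "\<dots> = (1 + sqrt g + g)\<^sup>2 * T\<^sup>2 * M\<^sup>2" by (simp add: power_mult_distrib)
    also have "\<dots> \<le> (1 + sqrt g + g)\<^sup>2 * T\<^sup>2 * (C * a v v)"
      using M_le by (intro mult_left_mono) auto
    finally have "a v v * a v v \<le> (C * (1 + sqrt g + g)\<^sup>2 * T\<^sup>2) * a v v"
      by (simp add: power2_eq_square algebra_simps)
    then show ?thesis using av unfolding T2 by simp
  qed
qed

text \<open>On a trivial space \<open>C * (3 + 2 * g)\<^sup>2\<close> may be below 1; the truncation
  keeps \<open>rate\<close> and its powers nonnegative there too.\<close>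

definition rate :: real where
  "rate = max 0 (1 - 1 / (C * (3 + 2 * g)\<^sup>2))"

lemma half_sweep_rate:
  assumes "v \<in> V"
  shows "a (half_sweep v) (half_sweep v) \<le> rate * a v v"
proof -
  let ?K = "C * (3 + 2 * g)\<^sup>2" and ?e = "a (half_sweep v) (half_sweep v)"
  have K: "0 < ?K" using C_pos g_nonneg by simp
  \<comment> \<open>\<open>sqrt g \<le> 1 + g\<close> gives
    \<open>1 + sqrt g + g \<le> 2 + 2 * g\<close>, which is below \<open>3 + 2 * g\<close>.\<close>
  have "C * (1 + sqrt g + g)\<^sup>2 \<le> ?K"
  proof -
    have "sqrt g \<le> 1 + g"
      using g_nonneg by (intro real_le_lsqrt) (auto simp: power2_eq_square algebra_simps)
    then show ?thesis using C_pos g_nonneg by (intro mult_left_mono power_mono) auto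
  qed
  \<comment> \<open>Enlarging the constant requires a nonnegative energy loss. A negative loss would
    make the right-hand side of \<open>half_sweep_energy\<close> negative, against
    \<open>0 \<le> a v v\<close>.\<close>
  moreover have "0 \<le> a v v - ?e"
  proof (rule ccontr)
    assume neg: "\<not> ?thesis"
    have "0 < C * (1 + sqrt g + g)\<^sup>2"
      using C_pos g_nonneg by (intro mult_pos_pos zero_less_power) (auto simp: add_pos_nonneg)
    then have "C * (1 + sqrt g + g)\<^sup>2 * (a v v - ?e) < 0"
      using neg by (intro mult_pos_neg) auto
    then show False using half_sweep_energy[OF assms] nonneg[OF assms] by linarith
  qed
  ultimately have "a v v \<le> ?K * (a v v - ?e)"
    using half_sweep_energy[OF assms] mult_right_mono order_trans by blast
  then have "a v v / ?K \<le> a v v - ?e" using K by (simp add: pos_divide_le_eq mult.commute)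
  then have "?e \<le> (1 - 1 / ?K) * a v v" by (simp add: left_diff_distrib)
  also have "\<dots> \<le> rate * a v v"
    unfolding rate_def using nonneg[OF assms] by (intro mult_right_mono) auto
  finally show ?thesis .
qed

section \<open>Contraction of the symmetric smoother and of its powers\<close>

abbreviation S :: "('a \<Rightarrow> real) \<Rightarrow> 'a \<Rightarrow> real" where
  "S \<equiv> symmetric_ssc P p"

lemma rate_bounds: "0 \<le> rate" "rate \<le> 1"
  unfolding rate_def using C_pos by auto

lemma S_mem: "v \<in> V \<Longrightarrow> S v \<in> V"
  by (simp add: symmetric_ssc_eq half_sweep_mem)

lemma S_sym: "u \<in> V \<Longrightarrow> v \<in> V \<Longrightarrow> a (S u) v = a u (S v)"
  using half_sweep_adjoint[of "half_sweep u" v] half_sweep_adjoint[of "half_sweep v" u]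
    sym[of "half_sweep u" "half_sweep v"] sym[of u "half_sweep_adj (half_sweep v)"]
  by (simp add: symmetric_ssc_eq half_sweep_mem)

text \<open>An operator and its adjoint have the same norm:
  \<open>a ?x ?x = a u (half_sweep ?x)\<close> is bounded by Cauchy-Schwarz and the rate of
  \<open>half_sweep\<close>, and after squaring one factor \<open>a ?x ?x\<close> cancels.\<close>

lemma half_sweep_adj_rate:
  assumes "u \<in> V"
  shows "a (half_sweep_adj u) (half_sweep_adj u) \<le> rate * a u u"
proof -
  let ?x = "half_sweep_adj u"
  have x: "?x \<in> V" "half_sweep ?x \<in> V" using assms half_sweep_mem by auto
  have nn: "0 \<le> a ?x ?x" "0 \<le> a u u" using nonneg x assms by auto
  have "a ?x ?x = a u (half_sweep ?x)" using half_sweep_adjoint assms x by simp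
  also have "\<dots> \<le> sqrt (a u u) * sqrt (a (half_sweep ?x) (half_sweep ?x))"
    using cauchy_schwarz[OF assms x(2)] by simp
  also have "\<dots> \<le> sqrt (a u u) * sqrt (rate * a ?x ?x)"
    using half_sweep_rate[OF x(1)] nn by (intro mult_left_mono) auto
  finally have "(a ?x ?x)\<^sup>2 \<le> (sqrt (a u u) * sqrt (rate * a ?x ?x))\<^sup>2"
    using nn by (intro power_mono) auto
  also have "\<dots> = (rate * a u u) * a ?x ?x"
    using nn rate_bounds by (simp add: power_mult_distrib)
  finally show ?thesis
    using nn rate_bounds by (cases "a ?x ?x = 0") (auto simp: power2_eq_square)
qed

lemma S_rate:
  assumes "v \<in> V"
  shows "a (S v) (S v) \<le> rate\<^sup>2 * a v v"
proof -
  have "a (S v) (S v) \<le> rate * a (half_sweep v) (half_sweep v)"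
    unfolding symmetric_ssc_eq using half_sweep_adj_rate half_sweep_mem assms by blast
  also have "\<dots> \<le> rate * (rate * a v v)"
    using half_sweep_rate[OF assms] rate_bounds by (intro mult_left_mono) auto
  finally show ?thesis by (simp add: power2_eq_square)
qed

lemma S_power_mem: "v \<in> V \<Longrightarrow> (S ^^ n) v \<in> V"
  by (induction n) (auto simp: S_mem)

lemma S_power_sym: "u \<in> V \<Longrightarrow> v \<in> V \<Longrightarrow> a ((S ^^ n) u) v = a u ((S ^^ n) v)"
proof (induction n arbitrary: v)
  case (Suc n)
  then have "a ((S ^^ Suc n) u) v = a u ((S ^^ n) (S v))"
    by (simp add: S_sym S_power_mem S_mem)
  then show ?case by (simp only: funpow.simps comp_apply funpow_swap1)
qed simp

lemma S_power_rate: "v \<in> V \<Longrightarrow> a ((S ^^ n) v) ((S ^^ n) v) \<le> rate ^ (2 * n) * a v v"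
proof (induction n)
  case (Suc n)
  have "a ((S ^^ Suc n) v) ((S ^^ Suc n) v) \<le> rate\<^sup>2 * a ((S ^^ n) v) ((S ^^ n) v)"
    using S_rate[OF S_power_mem[OF Suc.prems]] by simp
  also have "\<dots> \<le> rate\<^sup>2 * (rate ^ (2 * n) * a v v)"
    using Suc by (intro mult_left_mono) auto
  finally show ?case by (simp add: power2_eq_square algebra_simps)
qed simp

text \<open>Each of the \<open>n\<close> steps multiplies the energy by at most
  \<open>rate\<^sup>2\<close>, one factor for \<open>half_sweep\<close> and one for its adjoint.
  Bernoulli with exponent \<open>2 * n\<close> therefore produces the \<open>2 * real m\<close> in
  the denominator of \<open>mg_rate\<close>.\<close>

lemma S_power_mg_rate:
  assumes "v \<in> V"
  shows "a ((S ^^ n) v) ((S ^^ n) v) \<le> mg_rate C g n * a v v"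
proof -
  have "0 < C * (3 + 2 * g)\<^sup>2" using C_pos g_nonneg by simp
  from max_power_bernoulli[OF this, of "2 * n"] have "rate ^ (2 * n) \<le> mg_rate C g n"
    unfolding rate_def mg_rate_def by simp
  then show ?thesis
    using S_power_rate[OF assms, of n] nonneg[OF assms] mult_right_mono order_trans by blast
qed

end

lemma mg_rate_bounds:
  assumes "0 < C" "0 \<le> g"
  shows "mg_rate C g m \<le> 1" "1 \<le> m \<Longrightarrow> mg_rate C g m < 1"
proof -
  have "0 < C * (3 + 2 * g)\<^sup>2" using assms by simp
  then show "mg_rate C g m \<le> 1" "1 \<le> m \<Longrightarrow> mg_rate C g m < 1"
    unfolding mg_rate_def by (auto simp: field_simps add_pos_nonneg)
qed

text \<open>The coarse correction does not increase the energy, so the smoothing steps alone already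
  give the rate.\<close>

lemma vcycle_step:
  fixes n :: nat
  assumes "subspace_correction V a W p C g G"
    and S: "\<And>v. v \<in> V \<Longrightarrow> S v = symmetric_ssc (\<lambda>i. orth_proj a (W i)) p v"
    and U: "fun_subspace U" "U \<subseteq> V"
    and E: "\<And>u. u \<in> U \<Longrightarrow> E u \<in> U" "\<And>u. u \<in> U \<Longrightarrow> a (E u) u \<le> a u u"
    and v: "v \<in> V"
  defines "F \<equiv> (S ^^ n) \<circ> id_minus (id_minus E \<circ> orth_proj a U) \<circ> (S ^^ n)"
  shows "F v \<in> V" "a (F v) v \<le> mg_rate C g n * a v v"
proof -
  interpret subspace_correction V a W p C g G by fact
  let ?S = "symmetric_ssc P p"
  \<comment> \<open>\<open>S\<close> is known to agree with the symmetric sweep only on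
    \<open>V\<close>, so the powers are compared along an orbit that stays in
    \<open>V\<close>.\<close>
  have Sm: "(S ^^ n) u = (?S ^^ n) u" if "u \<in> V" for u
    by (induction n) (auto simp: S S_power_mem that)
  define w where "w = (?S ^^ n) v"
  have wV: "w \<in> V" unfolding w_def by (rule S_power_mem[OF v])
  define q where "q = orth_proj a U w"
  have qU: "q \<in> U" unfolding q_def by (rule orth_proj_mem[OF U wV])
  have q: "a q x = a w x" if "x \<in> U" for x
    unfolding q_def by (rule orth_proj_apply[OF U wV that])
  have qV: "q \<in> V" "E q \<in> U" "E q \<in> V" using qU U E by auto
  define z where "z = id_minus (id_minus E \<circ> orth_proj a U) w"
  have z: "z = w - q + E q"
    unfolding z_def id_minus_def q_def[symmetric] by (auto simp: q_def)
  have zV: "z \<in> V" unfolding z using wV qV add_mem diff_mem by blast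
  have F: "F v = (?S ^^ n) z" unfolding F_def comp_apply Sm[OF v] w_def[symmetric] z_def[symmetric]
    by (rule Sm[OF zV])
  show "F v \<in> V" unfolding F by (rule S_power_mem[OF zV])
  \<comment> \<open>Symmetry moves the post-smoothing powers onto \<open>v\<close>, so both
    arguments see the smoothed function \<open>w\<close>.\<close>
  have "a (F v) v = a z w" unfolding F w_def by (rule S_power_sym[OF zV v])
  also have "\<dots> = a w w - a q w + a (E q) w"
    unfolding z using wV qV by (simp add: add_left diff_left diff_mem)
  \<comment> \<open>\<open>q\<close> and \<open>E q\<close> lie in \<open>U\<close>, where testing
    with \<open>w\<close> equals testing with its projection \<open>q\<close>. So \<open>E\<close>
    enters only through its form on \<open>U\<close>, which \<open>a q q\<close> bounds.\<close>
  also have "a q w = a q q" using q[OF qU] sym[OF qV(1) wV] by simp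
  also have "a (E q) w = a (E q) q"
    using q[OF qV(2)] sym[OF wV qV(3)] sym[OF qV(1) qV(3)] by simp
  also have "a w w - a q q + a (E q) q \<le> a w w" using E(2)[OF qU] by simp
  also have "\<dots> \<le> mg_rate C g n * a v v" unfolding w_def by (rule S_power_mg_rate[OF v])
  finally show "a (F v) v \<le> mg_rate C g n * a v v" .
qed

section \<open>Weak derivatives\<close>

definition C1_fun :: "(real^'n::finite \<Rightarrow> real) \<Rightarrow> bool" where
  "C1_fun f \<longleftrightarrow> (\<forall>x. f differentiable (at x)) \<and> (\<forall>i. continuous_on UNIV (partial i f))"

lemma partial_eqI: "(f has_derivative f') (at x) \<Longrightarrow> partial i f x = f' (axis i 1)"
  unfolding partial_def by (metis frechet_derivative_at)

lemma C1_fun_derivative: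
  "C1_fun f \<Longrightarrow> (f has_derivative frechet_derivative f (at x)) (at x)"
  unfolding C1_fun_def using frechet_derivative_works by blast

lemma C1_funI:
  assumes "\<And>x. (f has_derivative f' x) (at x)" "\<And>i. continuous_on UNIV (\<lambda>x. f' x (axis i 1))"
  shows "C1_fun f"
proof -
  have "partial i f = (\<lambda>x. f' x (axis i 1))" for i using partial_eqI[OF assms(1)] by blast
  then show ?thesis unfolding C1_fun_def using assms differentiable_def by metis
qed

lemma C1_fun_continuous: "C1_fun f \<Longrightarrow> continuous_on UNIV f"
  unfolding C1_fun_def
  by (simp add: continuous_on_eq_continuous_at differentiable_imp_continuous_within)

lemma C1_fun_partial_continuous: "C1_fun f \<Longrightarrow> continuous_on UNIV (partial i f)"
  unfolding C1_fun_def by blast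

lemma
  assumes "C1_fun f" "C1_fun g"
  shows C1_fun_add: "C1_fun (\<lambda>x. f x + g x)"
    and C1_fun_mult: "C1_fun (\<lambda>x. f x * g x)"
    and partial_mult: "partial i (\<lambda>x. f x * g x) x = f x * partial i g x + partial i f x * g x"
proof -
  note d = C1_fun_derivative[OF assms(1)] C1_fun_derivative[OF assms(2)]
  note c = C1_fun_continuous[OF assms(1)] C1_fun_continuous[OF assms(2)]
    C1_fun_partial_continuous[OF assms(1)] C1_fun_partial_continuous[OF assms(2)]
  show "C1_fun (\<lambda>x. f x + g x)"
    using c by (intro C1_funI[OF has_derivative_add[OF d]])
      (auto simp: partial_def[symmetric] intro!: continuous_intros)
  show "C1_fun (\<lambda>x. f x * g x)"
    using c by (intro C1_funI[OF has_derivative_mult[OF d]])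
      (auto simp: partial_def[symmetric] intro!: continuous_intros)
  show "partial i (\<lambda>x. f x * g x) x = f x * partial i g x + partial i f x * g x"
    using partial_eqI[OF has_derivative_mult[OF d]] by (simp add: partial_def)
qed

lemma C1_fun_const: "C1_fun (\<lambda>x. c)"
  by (rule C1_funI[of _ "\<lambda>_ _. 0"]) auto

lemma C1_fun_cmult: "C1_fun f \<Longrightarrow> C1_fun (\<lambda>x. c * f x)"
  by (rule C1_fun_mult[OF C1_fun_const])

lemma C1_fun_sum: "(\<And>k. k \<in> I \<Longrightarrow> C1_fun (f k)) \<Longrightarrow> C1_fun (\<lambda>x. \<Sum>k\<in>I. f k x)"
  by (induction I rule: infinite_finite_induct) (auto intro: C1_fun_const C1_fun_add)

lemma C1_fun_compose:
  assumes "C1_fun f" "\<And>y. (h has_real_derivative h' y) (at y)" "continuous_on UNIV h'"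
  shows "C1_fun (\<lambda>x. h (f x))"
proof (rule C1_funI)
  show "((\<lambda>x. h (f x)) has_derivative (\<lambda>e. h' (f x) * frechet_derivative f (at x) e)) (at x)" for x
    using diff_chain_at[OF C1_fun_derivative[OF assms(1)], of h, OF assms(2)[unfolded has_field_derivative_def]]
    by (simp add: o_def)
  show "continuous_on UNIV (\<lambda>x. h' (f x) * frechet_derivative f (at x) (axis i 1))" for i
    using C1_fun_partial_continuous[OF assms(1)] C1_fun_continuous[OF assms(1)]
    by (auto simp: partial_def[symmetric] intro!: continuous_intros continuous_on_compose2[OF assms(3)])
qed

text \<open>Squaring removes the kink of \<open>max 0\<close>: at 0 the difference quotient is at
  most \<open>\<bar>h\<bar>\<close>. It supplies the C1 bumps from which test functions are
  built.\<close>

lemma DERIV_max_0_square: "((\<lambda>y. (max 0 y)\<^sup>2) has_real_derivative 2 * max 0 y) (at y)"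
proof (cases "y = 0")
  case True
  have "((\<lambda>h::real. (max 0 h)\<^sup>2 / h) \<longlongrightarrow> 0) (at 0)"
  proof (rule Lim_null_comparison)
    show "\<forall>\<^sub>F h in at 0. norm ((max 0 h)\<^sup>2 / h) \<le> \<bar>h::real\<bar>"
      by (intro always_eventually) (auto simp: max_def power2_eq_square)
    show "((\<lambda>h::real. \<bar>h\<bar>) \<longlongrightarrow> 0) (at 0)"
      by (intro tendsto_rabs_zero tendsto_ident_at)
  qed
  then show ?thesis unfolding True by (simp add: DERIV_def)
next
  case False
  show ?thesis
  proof (cases "0 < y")
    case True
    have "((\<lambda>y. y\<^sup>2) has_real_derivative 2 * max 0 y) (at y)"
      using True by (auto intro!: derivative_eq_intros)
    then show ?thesis
      by (rule has_field_derivative_transform_within_open[of _ _ _ "{0<..}"]) (use True in auto)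
  next
    case False
    have "((\<lambda>y. 0) has_real_derivative 2 * max 0 y) (at y)" using False by simp
    then show ?thesis
      by (rule has_field_derivative_transform_within_open[of _ _ _ "{..<0}"])
        (use False \<open>y \<noteq> 0\<close> in auto)
  qed
qed

lemma C1_fun_bump: "C1_fun (\<lambda>x. (max 0 (r\<^sup>2 - (dist x c)\<^sup>2))\<^sup>2)"
proof -
  \<comment> \<open>The squared distance is written as an inner product, a polynomial, because the
    distance itself is not differentiable at the centre.\<close>
  have "C1_fun (\<lambda>x. r\<^sup>2 - (x - c) \<bullet> (x - c))"
    by (rule C1_funI[of _ "\<lambda>x e. - ((x - c) \<bullet> e + e \<bullet> (x - c))"])
      (auto intro!: derivative_eq_intros continuous_intros)
  then have "C1_fun (\<lambda>x. (max 0 (r\<^sup>2 - (x - c) \<bullet> (x - c)))\<^sup>2)"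
    by (rule C1_fun_compose[OF _ DERIV_max_0_square]) (intro continuous_intros)
  then show ?thesis by (simp add: dist_norm power2_norm_eq_inner)
qed

section \<open>Test functions and the fundamental lemma of the calculus of variations\<close>

lemma test_functions_C1: "\<phi> \<in> test_functions \<Omega> \<Longrightarrow> C1_fun \<phi>"
  unfolding test_functions_def C1_fun_def by blast

lemma test_functionsI:
  assumes "C1_fun \<phi>" "compact K" "K \<subseteq> \<Omega>" "\<And>x. x \<notin> K \<Longrightarrow> \<phi> x = 0"
  shows "\<phi> \<in> test_functions \<Omega>"
proof -
  have "closure {x. \<phi> x \<noteq> 0} \<subseteq> K"
    using assms by (intro closure_minimal compact_imp_closed) auto
  moreover from this have "compact (closure {x. \<phi> x \<noteq> 0})"
    using assms(2) by (metis closed_closure compact_Int_closed inf.absorb_iff2)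
  ultimately show ?thesis using assms unfolding test_functions_def C1_fun_def by auto
qed

lemma test_functions_support:
  assumes "\<phi> \<in> test_functions \<Omega>"
  shows "\<exists>K. compact K \<and> K \<subseteq> \<Omega> \<and> (\<forall>x. x \<notin> K \<longrightarrow> \<phi> x = 0)"
proof (intro exI conjI allI impI)
  show "compact (closure {x. \<phi> x \<noteq> 0})" "closure {x. \<phi> x \<noteq> 0} \<subseteq> \<Omega>"
    using assms unfolding test_functions_def by auto
  show "\<phi> x = 0" if "x \<notin> closure {x. \<phi> x \<noteq> 0}" for x
    using that closure_subset[of "{x. \<phi> x \<noteq> 0}"] by blast
qed

lemma partial_zero_open:
  assumes "open U" "x \<in> U" "\<And>y. y \<in> U \<Longrightarrow> f y = 0"
  shows "partial i f x = 0"
proof -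
  have "((\<lambda>y. 0) has_derivative (\<lambda>e. 0)) (at x)" by simp
  then have "(f has_derivative (\<lambda>e. 0)) (at x)"
    by (rule has_derivative_transform_within_open[OF _ assms(1,2)]) (simp add: assms(3))
  then show ?thesis by (rule partial_eqI)
qed

lemma partial_zero_outside:
  assumes "compact K" "\<forall>x. x \<notin> K \<longrightarrow> f x = 0" "x \<notin> K"
  shows "partial i f x = 0"
  using partial_zero_open[of "- K" x f] assms compact_imp_closed by auto

lemma test_functions_zero: "(\<lambda>x. 0) \<in> test_functions \<Omega>"
  by (rule test_functionsI[of _ "{}"]) (auto intro: C1_fun_const)

lemma test_functions_add:
  assumes "\<phi> \<in> test_functions \<Omega>" "\<psi> \<in> test_functions \<Omega>"
  shows "(\<lambda>x. \<phi> x + \<psi> x) \<in> test_functions \<Omega>"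
proof -
  obtain K where K: "compact K" "K \<subseteq> \<Omega>" "\<And>x. x \<notin> K \<Longrightarrow> \<phi> x = 0"
    using test_functions_support[OF assms(1)] by blast
  obtain L where L: "compact L" "L \<subseteq> \<Omega>" "\<And>x. x \<notin> L \<Longrightarrow> \<psi> x = 0"
    using test_functions_support[OF assms(2)] by blast
  show ?thesis
    using K L assms by (intro test_functionsI[of _ "K \<union> L"])
      (auto intro: C1_fun_add test_functions_C1)
qed

lemma test_functions_cmult:
  assumes "\<phi> \<in> test_functions \<Omega>"
  shows "(\<lambda>x. c * \<phi> x) \<in> test_functions \<Omega>"
proof -
  obtain K where K: "compact K" "K \<subseteq> \<Omega>" "\<And>x. x \<notin> K \<Longrightarrow> \<phi> x = 0"
    using test_functions_support[OF assms] by blast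
  show ?thesis
    using K assms by (intro test_functionsI[of _ K]) (auto intro: C1_fun_cmult test_functions_C1)
qed

lemma test_functions_mono: "U \<subseteq> \<Omega> \<Longrightarrow> test_functions U \<subseteq> test_functions \<Omega>"
  unfolding test_functions_def by blast

text \<open>With \<open>h y = y\<^sup>2 / (1 + y\<^sup>2)\<close> and \<open>B\<^sub>N\<close> the sum of the first \<open>N\<close> bumps of a countable
  cover of the open set by balls, the test functions \<open>h (N B\<^sub>N)\<close> converge boundedly to its
  indicator function.\<close>

lemma set_integral_open_zero:
  fixes g :: "real^'n::finite \<Rightarrow> real"
  assumes g: "set_integrable lebesgue U g"
    and test: "\<And>\<phi>. \<phi> \<in> test_functions U \<Longrightarrow> (LINT x:U|lebesgue. g x * \<phi> x) = 0"
    and A: "open A" "A \<subseteq> U"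
  shows "(LINT x:A|lebesgue. g x) = 0"
proof (cases "A = {}")
  case True
  then show ?thesis by (simp add: set_lebesgue_integral_def)
next
  case False
  let ?F = "{ball c r | c r. cball c r \<subseteq> A}"
  obtain F' where F': "F' \<subseteq> ?F" "countable F'" "\<Union>F' = \<Union>?F"
    by (rule Lindelof[of ?F]) auto
  have cover: "\<Union>F' = A"
  proof
    show "\<Union>F' \<subseteq> A" using F'(1) ball_subset_cball by fast
    show "A \<subseteq> \<Union>F'"
    proof
      fix x assume "x \<in> A"
      then obtain e where "0 < e" "cball x e \<subseteq> A" using A(1) open_contains_cball by metis
      then have "x \<in> \<Union>?F" by (intro UnionI[of "ball x e"]) auto
      then show "x \<in> \<Union>F'" using F'(3) by simp
    qed
  qed
  then have "F' \<noteq> {}" using False by auto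
  have "\<forall>k. \<exists>c r. from_nat_into F' k = ball c r \<and> cball c r \<subseteq> A"
    using from_nat_into[OF \<open>F' \<noteq> {}\<close>] F'(1) by blast
  then obtain c r where cr: "\<And>k. from_nat_into F' k = ball (c k) (r k)"
    "\<And>k. cball (c k) (r k) \<subseteq> A" by metis
  have A_eq: "A = (\<Union>k. ball (c k) (r k))"
    unfolding cr(1)[symmetric] range_from_nat_into[OF \<open>F' \<noteq> {}\<close> F'(2)] by (rule cover[symmetric])
  define b where "b k x = (max 0 ((r k)\<^sup>2 - (dist x (c k))\<^sup>2))\<^sup>2" for k x
  define h :: "real \<Rightarrow> real" where "h y = 1 - 1 / (1 + y\<^sup>2)" for y
  \<comment> \<open>A negative radius gives an empty ball but a nonzero bump, as \<open>b\<close>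
    sees only the square of the radius; the condition \<open>0 < r k\<close> discards it. The factor
    \<open>N\<close> drives the argument of \<open>h\<close> to infinity at every point of
    \<open>A\<close>.\<close>
  define \<phi> where "\<phi> N x = h (real N * (\<Sum>k<N. if 0 < r k then b k x else 0))" for N x
  have pos: "0 < 1 + y\<^sup>2" for y :: real by (simp add: add_pos_nonneg)
  have h0: "h 0 = 0" and h01: "0 \<le> h y" "h y \<le> 1" for y unfolding h_def using pos[of y] by auto
  have out: "b k x = 0" if "x \<notin> cball (c k) (r k)" "0 < r k" for k x
  proof -
    have "(r k)\<^sup>2 \<le> (dist x (c k))\<^sup>2" using that by (intro power_mono) (auto simp: dist_commute)
    then show ?thesis unfolding b_def by simp
  qed
  have \<phi>_test: "\<phi> N \<in> test_functions A" for N
  proof (rule test_functionsI)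
    have "C1_fun (\<lambda>x. if 0 < r k then b k x else 0)" for k
      unfolding b_def by (cases "0 < r k") (simp_all only: if_True if_False C1_fun_bump C1_fun_const)
    then have "C1_fun (\<lambda>x. real N * (\<Sum>k<N. if 0 < r k then b k x else 0))"
      by (intro C1_fun_cmult C1_fun_sum)
    moreover have "(h has_real_derivative 2 * y / (1 + y\<^sup>2)\<^sup>2) (at y)" for y
      unfolding h_def using pos[of y] by (auto intro!: derivative_eq_intros simp: power2_eq_square)
    moreover have "continuous_on UNIV (\<lambda>y::real. 2 * y / (1 + y\<^sup>2)\<^sup>2)"
      using pos by (intro continuous_intros) (auto simp: less_imp_neq[symmetric])
    ultimately show "C1_fun (\<phi> N)" unfolding \<phi>_def by (rule C1_fun_compose)
    show "compact (\<Union>k<N. cball (c k) (r k))" by auto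
    show "(\<Union>k<N. cball (c k) (r k)) \<subseteq> A" using cr(2) by blast
    show "\<phi> N x = 0" if "x \<notin> (\<Union>k<N. cball (c k) (r k))" for x
    proof -
      have "(\<Sum>k<N. if 0 < r k then b k x else 0) = 0"
        using out that by (intro sum.neutral) auto
      then show ?thesis unfolding \<phi>_def using h0 by simp
    qed
  qed
  have lim: "(\<lambda>N. \<phi> N x) \<longlonglongrightarrow> indicator A x" for x
  proof (cases "x \<in> A")
    case True
    then obtain k where k: "x \<in> ball (c k) (r k)" using A_eq by blast
    then have rk: "0 < r k" using zero_le_dist[of "c k" x] unfolding mem_ball by linarith
    have "(dist x (c k))\<^sup>2 < (r k)\<^sup>2"
      using k by (intro power_strict_mono) (auto simp: dist_commute)
    then have bk: "0 < b k x" unfolding b_def by simp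
    have "filterlim (\<lambda>N. real N * b k x) at_top sequentially"
      by (rule filterlim_at_top_mult_tendsto_pos[OF tendsto_const bk filterlim_real_sequentially])
    then have "filterlim (\<lambda>N. real N * (\<Sum>k<N. if 0 < r k then b k x else 0)) at_top sequentially"
    proof (rule filterlim_at_top_mono)
      show "\<forall>\<^sub>F N in sequentially. real N * b k x \<le> real N * (\<Sum>k<N. if 0 < r k then b k x else 0)"
      proof (rule eventually_sequentiallyI)
        fix N assume "Suc k \<le> N"
        then have "(if 0 < r k then b k x else 0) \<le> (\<Sum>k<N. if 0 < r k then b k x else 0)"
          by (intro member_le_sum) (auto simp: b_def)
        then show "real N * b k x \<le> real N * (\<Sum>k<N. if 0 < r k then b k x else 0)"
          using rk by (intro mult_left_mono) auto
      qed
    qed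
    moreover have "(h \<longlongrightarrow> 1 - 0) at_top"
      unfolding h_def
      by (intro tendsto_diff tendsto_const tendsto_divide_0[OF tendsto_const]
          filterlim_at_top_imp_at_infinity filterlim_tendsto_add_at_top[OF tendsto_const]
          filterlim_pow_at_top filterlim_ident) auto
    ultimately have "(\<lambda>N. \<phi> N x) \<longlonglongrightarrow> 1 - 0"
      unfolding \<phi>_def by (rule filterlim_compose[rotated])
    then show ?thesis using True by simp
  next
    case False
    have "\<phi> N x = 0" for N
      using test_functions_support[OF \<phi>_test[of N]] False by blast
    then show ?thesis using False by simp
  qed
  let ?g = "\<lambda>x. indicator U x * g x"
  have gi: "integrable lebesgue ?g" using g unfolding set_integrable_def by simp
  have "(\<lambda>N. LINT x|lebesgue. ?g x * \<phi> N x) \<longlonglongrightarrow> (LINT x|lebesgue. ?g x * indicator A x)"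
  proof (rule integral_dominated_convergence[where w = "\<lambda>x. \<bar>?g x\<bar>"])
    have [measurable]: "\<phi> N \<in> borel_measurable lebesgue" for N
      using borel_measurable_continuous_onI[OF C1_fun_continuous[OF test_functions_C1[OF \<phi>_test[of N]]]]
      by (intro measurable_completion) simp
    have [measurable]: "?g \<in> borel_measurable lebesgue" using gi by (rule borel_measurable_integrable)
    have [measurable]: "A \<in> sets lebesgue" using A(1) by (simp add: borel_open)
    show "(\<lambda>x. ?g x * indicator A x) \<in> borel_measurable lebesgue"
      "(\<lambda>x. ?g x * \<phi> N x) \<in> borel_measurable lebesgue" for N by measurable
    show "integrable lebesgue (\<lambda>x. \<bar>?g x\<bar>)" using gi by (rule integrable_abs)
    show "AE x in lebesgue. (\<lambda>N. ?g x * \<phi> N x) \<longlonglongrightarrow> ?g x * indicator A x"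
      using lim by (intro AE_I2 tendsto_mult_left)
    show "AE x in lebesgue. norm (?g x * \<phi> N x) \<le> \<bar>?g x\<bar>" for N
      using h01 by (intro AE_I2) (auto simp: abs_mult \<phi>_def intro!: mult_left_le)
  qed
  moreover have "(LINT x|lebesgue. ?g x * \<phi> N x) = 0" for N
    using test[of "\<phi> N"] \<phi>_test[of N] test_functions_mono[OF A(2)]
    by (auto simp: set_lebesgue_integral_def mult.assoc)
  ultimately have "(LINT x|lebesgue. ?g x * indicator A x) = 0"
    by (simp only: LIMSEQ_const_iff)
  moreover have "?g x * indicator A x = indicator A x * g x" for x
    using A(2) by (auto simp: indicator_def)
  ultimately show ?thesis by (simp add: set_lebesgue_integral_def)
qed

text \<open>Integrals over open sets vanish by \<open>set_integral_open_zero\<close>. Open sets are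
  stable under intersection and generate the Borel sets, so Dynkin induction extends this to all
  Borel sets, and an integrable function whose integrals all vanish is zero almost
  everywhere.\<close>

lemma fundamental_lemma:
  fixes g :: "real^'n::finite \<Rightarrow> real"
  assumes U: "open U" and g: "set_integrable lebesgue U g"
    and test: "\<And>\<phi>. \<phi> \<in> test_functions U \<Longrightarrow> (LINT x:U|lebesgue. g x * \<phi> x) = 0"
  shows "AE x in lebesgue. x \<in> U \<longrightarrow> g x = 0"
proof -
  define f where "f x = indicator U x * g x" for x
  have f: "integrable lebesgue f" using g unfolding set_integrable_def f_def by simp
  \<comment> \<open>Open sets generate the Borel sets but not the Lebesgue sets, so the induction
    runs on a Borel function equal to \<open>f\<close> almost everywhere.\<close>
  obtain f' where f': "f' \<in> borel_measurable lborel" "AE x in lborel. f x = f' x"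
    using completion_ex_borel_measurable_real[OF borel_measurable_integrable[OF f]] by blast
  have ae: "AE x in lebesgue. f x = f' x" using f'(2) by (rule AE_completion)
  have "integrable lebesgue f'"
    by (rule integrable_cong_AE_imp[OF f measurable_completion[OF f'(1)]]) (use ae in auto)
  then have f'i: "integrable lborel f'" using integrable_completion[OF f'(1)] by simp
  have open_zero: "(LINT x:A|lborel. f' x) = 0" if A: "open A" for A
  proof -
    have [measurable]: "A \<in> sets borel" using A by simp
    have "(LINT x:A|lborel. f' x) = (LINT x|lebesgue. indicator A x * f' x)"
      unfolding set_lebesgue_integral_def using f'(1) by (subst integral_completion) auto
    also have "\<dots> = (LINT x|lebesgue. indicator A x * f x)"
    proof (rule integral_cong_AE)
      have [measurable]: "f' \<in> borel_measurable lebesgue" "f \<in> borel_measurable lebesgue"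
        "A \<in> sets lebesgue"
        using measurable_completion[OF f'(1)] borel_measurable_integrable[OF f] A
        by (auto intro: sets_completionI_sets)
      show "(\<lambda>x. indicator A x * f' x) \<in> borel_measurable lebesgue"
        "(\<lambda>x. indicator A x * f x) \<in> borel_measurable lebesgue" by measurable
      show "AE x in lebesgue. indicator A x * f' x = indicator A x * f x" using ae by auto
    qed
    also have "\<dots> = (LINT x:A \<inter> U|lebesgue. g x)"
      unfolding set_lebesgue_integral_def f_def
      by (intro Bochner_Integration.integral_cong) (auto simp: indicator_def)
    also have "\<dots> = 0" using A U by (intro set_integral_open_zero[OF g test]) auto
    finally show ?thesis .
  qed
  have si: "set_integrable lborel A f'" if "A \<in> sets borel" for A
    unfolding set_integrable_def using that f'i by (intro integrable_mult_indicator) auto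
  have zero: "(LINT x:A|lborel. f' x) = 0" if "A \<in> sets lborel" for A
  proof -
    have gen: "sets borel = sigma_sets (UNIV :: (real^'n) set) {S. open S}"
      unfolding borel_def by simp
    have "Int_stable {S :: (real^'n) set. open S}" by (auto simp: Int_stable_def)
    moreover have "{S :: (real^'n) set. open S} \<subseteq> Pow UNIV" by simp
    moreover have "A \<in> sigma_sets UNIV {S. open S}" using that gen by simp
    ultimately show ?thesis
    proof (induction rule: sigma_sets_induct_disjoint)
      case (basic A)
      then show ?case using open_zero by simp
    next
      case (compl A)
      then have "A \<in> sets borel" using gen by simp
      then have "(LINT x:A \<union> (UNIV - A)|lborel. f' x) = (LINT x:A|lborel. f' x) + (LINT x:UNIV - A|lborel. f' x)"
        by (intro set_integral_Un si) auto
      then show ?case using compl open_zero[of UNIV] by simp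
    next
      case (union A)
      then have m: "A i \<in> sets borel" for i using gen by auto
      then have "(LINT x:(\<Union>i. A i)|lborel. f' x) = (\<Sum>i. (LINT x:(A i)|lborel. f' x))"
        using union(1) by (intro lebesgue_integral_countable_add si sets.countable_UN)
          (auto simp: disjoint_family_on_def)
      then show ?case using union by simp
    qed (auto simp: set_lebesgue_integral_def)
  qed
  have "AE x in lborel. f' x = 0"
  proof (rule density_unique_real[OF f'i])
    show "(LINT x:A|lborel. f' x) = (LINT x:A|lborel. 0)" if "A \<in> sets lborel" for A
      using zero[OF that] by (simp add: set_lebesgue_integral_def)
  qed simp
  then have "AE x in lebesgue. f' x = 0" by (rule AE_completion)
  then show ?thesis using ae by eventually_elim (auto simp: f_def indicator_def)
qed

section \<open>Vanishing integrals of derivatives of compactly supported functions\<close>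

lemma partial_directional_derivative:
  assumes "C1_fun f"
  shows "((\<lambda>t. f (x + t *\<^sub>R axis i 1)) has_real_derivative partial i f (x + t *\<^sub>R axis i 1)) (at t)"
proof -
  have "((\<lambda>t. x + t *\<^sub>R axis i 1) has_derivative (\<lambda>t. t *\<^sub>R axis i 1)) (at t)"
    by (auto intro!: derivative_eq_intros)
  from diff_chain_at[OF this C1_fun_derivative[OF assms]]
  have d: "((\<lambda>t. f (x + t *\<^sub>R axis i 1)) has_derivative
      (\<lambda>s. frechet_derivative f (at (x + t *\<^sub>R axis i 1)) (s *\<^sub>R axis i 1))) (at t)"
    by (simp add: o_def)
  have lin: "linear (frechet_derivative f (at (x + t *\<^sub>R axis i 1)))"
    using C1_fun_derivative[OF assms] by (rule has_derivative_linear)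
  show ?thesis
    unfolding has_field_derivative_def partial_def
    by (rule has_derivative_eq_rhs[OF d]) (simp add: linear_scale[OF lin] fun_eq_iff mult.commute)
qed

text \<open>The integrals of the difference quotients vanish by translation invariance.\<close>

lemma integral_partial_zero:
  fixes f :: "real^'n::finite \<Rightarrow> real"
  assumes f: "C1_fun f" and K: "compact K" "\<forall>x. x \<notin> K \<longrightarrow> f x = 0"
  shows "(LINT x|lebesgue. partial i f x) = 0"
proof -
  let ?e = "axis i 1 :: real^'n"
  obtain R where R: "\<And>x. x \<in> K \<Longrightarrow> norm x \<le> R"
    using compact_imp_bounded[OF K(1)] unfolding bounded_iff by blast
  obtain L where L: "\<And>x. \<bar>partial i f x\<bar> \<le> L" "0 \<le> L"
  proof -
    have "compact (partial i f ` K)"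
      using C1_fun_partial_continuous[OF f] K(1)
      by (meson compact_continuous_image continuous_on_subset subset_UNIV)
    from compact_imp_bounded[OF this, unfolded bounded_iff]
    obtain L where L: "\<forall>y\<in>partial i f ` K. norm y \<le> L" ..
    have "\<bar>partial i f x\<bar> \<le> max L 0" for x
      using L partial_zero_outside[OF K, of x i] by (cases "x \<in> K") auto
    then show thesis using that[of "max L 0"] by auto
  qed
  have lip: "\<bar>f (x + t *\<^sub>R ?e) - f x\<bar> \<le> L * t" if "0 < t" for x t
  proof -
    obtain z where "f (x + t *\<^sub>R ?e) - f (x + 0 *\<^sub>R ?e) = (t - 0) * partial i f (x + z *\<^sub>R ?e)"
      using MVT2[OF \<open>0 < t\<close>, of "\<lambda>t. f (x + t *\<^sub>R ?e)" "\<lambda>t. partial i f (x + t *\<^sub>R ?e)"]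
        partial_directional_derivative[OF f] by blast
    then show ?thesis using L(1)[of "x + z *\<^sub>R ?e"] that
      by (simp add: abs_mult mult.commute mult_right_mono)
  qed
  \<comment> \<open>With shifts of length at most 1 all difference quotients vanish outside the ball
    of radius \<open>R + 1\<close>; together with the Lipschitz bound \<open>L\<close> this gives
    one integrable majorant.\<close>
  define \<delta> where "\<delta> n = 1 / real (Suc n)" for n
  have \<delta>: "0 < \<delta> n" "\<delta> n \<le> 1" for n unfolding \<delta>_def by auto
  define q where "q n x = (f (x + \<delta> n *\<^sub>R ?e) - f x) / \<delta> n" for n x
  have fm: "f \<in> borel_measurable borel"
    using C1_fun_continuous[OF f] by (rule borel_measurable_continuous_onI)
  have pm: "partial i f \<in> borel_measurable borel"
    using C1_fun_partial_continuous[OF f] by (rule borel_measurable_continuous_onI)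
  have fi: "integrable lborel f"
  proof -
    have "integrable lborel (\<lambda>x. indicator K x *\<^sub>R f x)"
      using K(1) C1_fun_continuous[OF f]
      by (intro borel_integrable_compact) (auto intro: continuous_on_subset)
    moreover have "(\<lambda>x. indicator K x *\<^sub>R f x) = f" using K(2) by (auto simp: indicator_def fun_eq_iff)
    ultimately show ?thesis by simp
  qed
  have shift: "integrable lborel (\<lambda>x. f (x + a))" "(LINT x|lborel. f (x + a)) = (LINT x|lborel. f x)" for a
  proof -
    have "integrable (distr lborel borel ((+) a)) f" using fi by (simp add: lborel_distr_plus)
    then show "integrable lborel (\<lambda>x. f (x + a))"
      using fm by (subst (asm) integrable_distr_eq) (auto simp: add.commute)
    have "(LINT x|distr lborel borel ((+) a). f x) = (LINT x|lborel. f (a + x))"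
      using fm by (intro integral_distr) auto
    then show "(LINT x|lborel. f (x + a)) = (LINT x|lborel. f x)"
      by (simp add: lborel_distr_plus add.commute)
  qed
  have q0: "(LINT x|lborel. q n x) = 0" for n
    unfolding q_def using shift fi by simp
  have "(\<lambda>n. LINT x|lborel. q n x) \<longlonglongrightarrow> (LINT x|lborel. partial i f x)"
  proof (rule integral_dominated_convergence[where w = "\<lambda>x. L * indicator (cball 0 (R + 1)) x"])
    show "partial i f \<in> borel_measurable lborel" using pm by simp
    show "q n \<in> borel_measurable lborel" for n
      unfolding q_def using borel_measurable_integrable shift(1) fi by measurable
    have "integrable lborel (indicator (cball 0 (R + 1)) :: real^'n \<Rightarrow> real)"
      using emeasure_bounded_finite[OF bounded_cball] by (intro integrable_real_indicator) auto
    then show "integrable lborel (\<lambda>x::real^'n. L * indicator (cball 0 (R + 1)) x)" by simp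
    show "AE x in lborel. (\<lambda>n. q n x) \<longlonglongrightarrow> partial i f x"
    proof (rule AE_I2)
      fix x
      have "((\<lambda>t. (f (x + t *\<^sub>R ?e) - f x) / t) \<longlongrightarrow> partial i f x) (at 0)"
        using partial_directional_derivative[OF f, of x i 0] by (simp add: DERIV_def)
      moreover have "filterlim \<delta> (at 0) sequentially"
        unfolding filterlim_at \<delta>_def using LIMSEQ_inverse_real_of_nat
        by (auto simp: inverse_eq_divide)
      ultimately show "(\<lambda>n. q n x) \<longlonglongrightarrow> partial i f x"
        unfolding q_def by (rule filterlim_compose)
    qed
    show "AE x in lborel. norm (q n x) \<le> L * indicator (cball 0 (R + 1)) x" for n
    proof (rule AE_I2)
      fix x
      show "norm (q n x) \<le> L * indicator (cball 0 (R + 1)) x"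
      proof (cases "x \<in> cball 0 (R + 1)")
        case True
        then show ?thesis using lip[OF \<delta>(1)[of n], of x] \<delta>(1)[of n]
          unfolding q_def by (simp add: pos_divide_le_eq)
      next
        case False
        have "norm x \<le> norm (x + \<delta> n *\<^sub>R ?e) + norm (\<delta> n *\<^sub>R ?e)"
          by (metis add_diff_cancel norm_triangle_sub norm_triangle_ineq4)
        also have "norm (\<delta> n *\<^sub>R ?e) \<le> 1" using \<delta>[of n] by simp
        finally have "x \<notin> K" "x + \<delta> n *\<^sub>R ?e \<notin> K"
          using R[of x] R[of "x + \<delta> n *\<^sub>R ?e"] False by auto
        then show ?thesis using K(2) L(2) unfolding q_def by simp
      qed
    qed
  qed
  then have "(LINT x|lborel. partial i f x) = 0" by (simp add: q0 LIMSEQ_const_iff)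
  then show ?thesis using pm by (simp add: integral_completion)
qed

section \<open>Square integrable functions and weak derivatives on a bounded open set\<close>

locale bounded_open =
  fixes \<Omega> :: "(real^'n::finite) set"
  assumes open_dom: "open \<Omega>" and bounded_dom: "bounded \<Omega>"
begin

text \<open>Extension by zero turns integrals over \<Omega> into integrals over the whole space,
  where the rules for sums and products of integrable functions apply directly.\<close>

definition zext :: "(real^'n \<Rightarrow> real) \<Rightarrow> real^'n \<Rightarrow> real" where
  "zext u x = indicator \<Omega> x * u x"

lemma zext_simps: "zext (\<lambda>x. u x + v x) x = zext u x + zext v x"
  "zext (\<lambda>x. c * u x) x = c * zext u x"
  unfolding zext_def by (auto simp: algebra_simps)

lemma l2_fun_iff:
  "l2_fun \<Omega> u \<longleftrightarrow> zext u \<in> borel_measurable lebesgue \<and> integrable lebesgue (\<lambda>x. (zext u x)\<^sup>2)"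
proof -
  have "(\<lambda>x. indicator \<Omega> x *\<^sub>R (u x)\<^sup>2) = (\<lambda>x. (zext u x)\<^sup>2)"
    unfolding zext_def by (auto simp: indicator_def)
  then show ?thesis
    unfolding l2_fun_def set_borel_measurable_def set_integrable_def
    by (simp add: zext_def[abs_def])
qed

lemma l2_fun_measurable: "l2_fun \<Omega> u \<Longrightarrow> zext u \<in> borel_measurable lebesgue"
  by (simp add: l2_fun_iff)

lemma l2_inner_eq: "l2_inner \<Omega> u v = (LINT x|lebesgue. zext u x * zext v x)"
  unfolding l2_inner_def set_lebesgue_integral_def
  by (intro Bochner_Integration.integral_cong) (auto simp: zext_def indicator_def)

lemma l2_product_integrable:
  assumes "l2_fun \<Omega> u" "l2_fun \<Omega> v"
  shows "integrable lebesgue (\<lambda>x. zext u x * zext v x)"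
proof (rule Bochner_Integration.integrable_bound)
  show "integrable lebesgue (\<lambda>x. (zext u x)\<^sup>2 + (zext v x)\<^sup>2)"
    using assms by (simp add: l2_fun_iff)
  show "(\<lambda>x. zext u x * zext v x) \<in> borel_measurable lebesgue"
    using assms by (intro borel_measurable_times l2_fun_measurable)
  have "\<bar>a * b\<bar> \<le> a\<^sup>2 + b\<^sup>2" for a b :: real
  proof -
    have "0 \<le> (\<bar>a\<bar> - \<bar>b\<bar>)\<^sup>2" "0 \<le> \<bar>a\<bar> * \<bar>b\<bar>" by auto
    then show ?thesis unfolding power2_diff power2_abs abs_mult by linarith
  qed
  then show "AE x in lebesgue. norm (zext u x * zext v x) \<le> norm ((zext u x)\<^sup>2 + (zext v x)\<^sup>2)"
    by (intro AE_I2) simp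
qed

lemma l2_product_set_integrable:
  assumes "l2_fun \<Omega> u" "l2_fun \<Omega> v"
  shows "set_integrable lebesgue \<Omega> (\<lambda>x. u x * v x)"
proof -
  have "(\<lambda>x. indicator \<Omega> x *\<^sub>R (u x * v x)) = (\<lambda>x. zext u x * zext v x)"
    unfolding zext_def by (auto simp: indicator_def)
  then show ?thesis using l2_product_integrable[OF assms] by (simp add: set_integrable_def)
qed

lemma l2_fun_add:
  assumes "l2_fun \<Omega> u" "l2_fun \<Omega> v"
  shows "l2_fun \<Omega> (\<lambda>x. u x + v x)"
proof -
  have "integrable lebesgue (\<lambda>x. (zext u x)\<^sup>2 + 2 * (zext u x * zext v x) + (zext v x)\<^sup>2)"
    using assms l2_product_integrable[OF assms] by (simp add: l2_fun_iff)
  moreover have "(zext (\<lambda>x. u x + v x) x)\<^sup>2 = (zext u x)\<^sup>2 + 2 * (zext u x * zext v x) + (zext v x)\<^sup>2" for x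
    unfolding zext_simps by (simp add: power2_sum)
  moreover have "zext (\<lambda>x. u x + v x) \<in> borel_measurable lebesgue"
    using borel_measurable_add[OF assms[THEN l2_fun_measurable]] by (simp add: zext_simps[abs_def])
  ultimately show ?thesis by (simp add: l2_fun_iff)
qed

lemma l2_fun_cmult:
  assumes "l2_fun \<Omega> u"
  shows "l2_fun \<Omega> (\<lambda>x. c * u x)"
  using assms borel_measurable_times[OF borel_measurable_const[of c] l2_fun_measurable[OF assms]]
  unfolding l2_fun_iff zext_simps[abs_def] by (simp add: power_mult_distrib)

text \<open>Boundedness of \<Omega> enters here: a continuous function is bounded on the compact
  closure, and \<Omega> has finite measure. Test functions, their partial derivatives and constants
  thus become admissible in \<open>l2_inner\<close>.\<close>

lemma l2_fun_continuous:
  assumes "continuous_on UNIV u"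
  shows "l2_fun \<Omega> u"
proof -
  obtain M where M: "\<And>x. x \<in> closure \<Omega> \<Longrightarrow> \<bar>u x\<bar> \<le> M"
  proof -
    have "compact (u ` closure \<Omega>)"
      using assms bounded_dom
      by (intro compact_continuous_image) (auto intro: continuous_on_subset)
    from compact_imp_bounded[OF this, unfolded bounded_iff]
    obtain M where "\<forall>y\<in>u ` closure \<Omega>. norm y \<le> M" ..
    then show thesis using that[of M] by simp
  qed
  have dom: "\<Omega> \<in> lmeasurable" using open_dom bounded_dom by (rule lmeasurable_open[rotated])
  have [measurable]: "\<Omega> \<in> sets lebesgue" using dom by blast
  have [measurable]: "u \<in> borel_measurable lebesgue"
    using borel_measurable_continuous_onI[OF assms] by (intro measurable_completion) simp
  have z: "zext u \<in> borel_measurable lebesgue" unfolding zext_def[abs_def] by measurable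
  have "integrable lebesgue (\<lambda>x. M\<^sup>2 * indicator \<Omega> x :: real)"
    using dom by (intro integrable_mult_right) (simp add: lmeasurable_iff_integrable)
  then have "integrable lebesgue (\<lambda>x. (zext u x)\<^sup>2)"
  proof (rule Bochner_Integration.integrable_bound)
    show "(\<lambda>x. (zext u x)\<^sup>2) \<in> borel_measurable lebesgue" using z by measurable
    have "(zext u x)\<^sup>2 \<le> M\<^sup>2 * indicator \<Omega> x" for x
      using M[of x] closure_subset[of \<Omega>] power_mono[of "\<bar>u x\<bar>" M 2]
      by (auto simp: zext_def indicator_def)
    then show "AE x in lebesgue. norm ((zext u x)\<^sup>2) \<le> norm (M\<^sup>2 * indicator \<Omega> x :: real)"
      by (intro AE_I2) (auto simp: indicator_def)
  qed
  with z show ?thesis by (simp add: l2_fun_iff)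
qed

lemma l2_inner_commute: "l2_inner \<Omega> u v = l2_inner \<Omega> v u"
  unfolding l2_inner_eq by (simp add: mult.commute)

lemma l2_inner_add_left:
  "l2_fun \<Omega> u \<Longrightarrow> l2_fun \<Omega> v \<Longrightarrow> l2_fun \<Omega> w \<Longrightarrow>
     l2_inner \<Omega> (\<lambda>x. u x + v x) w = l2_inner \<Omega> u w + l2_inner \<Omega> v w"
  unfolding l2_inner_eq zext_simps distrib_right by (simp add: l2_product_integrable)

lemma l2_inner_cmult_left: "l2_inner \<Omega> (\<lambda>x. c * u x) w = c * l2_inner \<Omega> u w"
  unfolding l2_inner_eq zext_simps by (simp add: mult.assoc)

lemma l2_inner_self_nonneg: "0 \<le> l2_inner \<Omega> u u"
  unfolding l2_inner_eq by (intro Bochner_Integration.integral_nonneg) simp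

lemma l2_inner_cong_AE:
  assumes "l2_fun \<Omega> u" "l2_fun \<Omega> u'" "l2_fun \<Omega> v" "AE x in lebesgue. x \<in> \<Omega> \<longrightarrow> u x = u' x"
  shows "l2_inner \<Omega> u v = l2_inner \<Omega> u' v"
  unfolding l2_inner_eq
proof (rule integral_cong_AE)
  show "AE x in lebesgue. zext u x * zext v x = zext u' x * zext v x"
    using assms(4) by eventually_elim (auto simp: zext_def indicator_def)
qed (use assms in \<open>auto intro!: borel_measurable_times l2_fun_measurable\<close>)

text \<open>The parallelogram identity with the nonnegative term for \<open>?w\<close>, that is
  \<open>u - v\<close>, dropped.\<close>

lemma l2_inner_add_self_le:
  assumes "l2_fun \<Omega> u" "l2_fun \<Omega> v"
  shows "l2_inner \<Omega> (\<lambda>x. u x + v x) (\<lambda>x. u x + v x) \<le> 2 * l2_inner \<Omega> u u + 2 * l2_inner \<Omega> v v"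
proof -
  let ?w = "\<lambda>x. u x + (-1) * v x"
  note l = assms l2_fun_cmult[OF assms(2), of "-1"]
  note s = l2_fun_add[OF assms] l2_fun_add[OF l(1,3)]
  have "l2_inner \<Omega> (\<lambda>x. u x + v x) (\<lambda>x. u x + v x)
      = l2_inner \<Omega> u u + 2 * l2_inner \<Omega> v u + l2_inner \<Omega> v v"
    using l s by (simp add: l2_inner_add_left l2_inner_commute[of u "\<lambda>x. u x + v x"]
      l2_inner_commute[of v "\<lambda>x. u x + v x"] l2_inner_commute[of u v])
  moreover have "l2_inner \<Omega> ?w ?w = l2_inner \<Omega> u u - 2 * l2_inner \<Omega> v u + l2_inner \<Omega> v v"
    using l s by (simp only: l2_inner_add_left l2_inner_cmult_left l2_inner_commute[of u ?w]
      l2_inner_commute[of v ?w] l2_inner_commute[of u v]) simp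
  ultimately show ?thesis using l2_inner_self_nonneg[of ?w] by linarith
qed

lemma test_function_l2: "\<phi> \<in> test_functions \<Omega> \<Longrightarrow> l2_fun \<Omega> \<phi>"
  and test_function_partial_l2: "\<phi> \<in> test_functions \<Omega> \<Longrightarrow> l2_fun \<Omega> (partial i \<phi>)"
  using l2_fun_continuous test_functions_C1 C1_fun_continuous C1_fun_partial_continuous by blast+

lemma has_weak_partial_iff:
  "has_weak_partial \<Omega> i u g \<longleftrightarrow> l2_fun \<Omega> g \<and>
     (\<forall>\<phi>\<in>test_functions \<Omega>. l2_inner \<Omega> u (partial i \<phi>) = - l2_inner \<Omega> g \<phi>)"
  unfolding has_weak_partial_def l2_inner_def ..

lemma has_weak_partial_add:
  "l2_fun \<Omega> u \<Longrightarrow> l2_fun \<Omega> v \<Longrightarrow> has_weak_partial \<Omega> i u g \<Longrightarrow> has_weak_partial \<Omega> i v h \<Longrightarrow>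
     has_weak_partial \<Omega> i (\<lambda>x. u x + v x) (\<lambda>x. g x + h x)"
  unfolding has_weak_partial_iff
  by (simp add: l2_inner_add_left l2_fun_add test_function_l2 test_function_partial_l2)

lemma has_weak_partial_cmult:
  "has_weak_partial \<Omega> i u g \<Longrightarrow> has_weak_partial \<Omega> i (\<lambda>x. c * u x) (\<lambda>x. c * g x)"
  unfolding has_weak_partial_iff by (simp add: l2_inner_cmult_left l2_fun_cmult)

text \<open>Integration by parts: \<open>\<phi> * \<psi>\<close> is C1 with compact support in
  \<Omega>, so its partial derivative integrates to zero, and the product rule splits that
  integral.\<close>

lemma has_weak_partial_test_function:
  assumes \<phi>: "\<phi> \<in> test_functions \<Omega>"
  shows "has_weak_partial \<Omega> i \<phi> (partial i \<phi>)"
  unfolding has_weak_partial_iff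
proof (intro conjI ballI)
  show "l2_fun \<Omega> (partial i \<phi>)" by (rule test_function_partial_l2[OF \<phi>])
  fix \<psi> assume \<psi>: "\<psi> \<in> test_functions \<Omega>"
  obtain K where K: "compact K" "K \<subseteq> \<Omega>" "\<forall>x. x \<notin> K \<longrightarrow> \<phi> x = 0"
    using test_functions_support[OF \<phi>] by blast
  have C1: "C1_fun \<phi>" "C1_fun \<psi>" using \<phi> \<psi> test_functions_C1 by auto
  have "(LINT x|lebesgue. partial i (\<lambda>x. \<phi> x * \<psi> x) x) = 0"
    using K by (intro integral_partial_zero[OF C1_fun_mult[OF C1] K(1)]) auto
  moreover have "partial i (\<lambda>x. \<phi> x * \<psi> x) x = zext \<phi> x * zext (partial i \<psi>) x + zext (partial i \<phi>) x * zext \<psi> x" for x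
    using K(2,3) partial_zero_outside[OF K(1,3), of x i]
    by (cases "x \<in> K") (auto simp: partial_mult[OF C1] zext_def)
  ultimately have "l2_inner \<Omega> \<phi> (partial i \<psi>) + l2_inner \<Omega> (partial i \<phi>) \<psi> = 0"
    unfolding l2_inner_eq using \<phi> \<psi>
    by (simp add: l2_product_integrable test_function_l2 test_function_partial_l2)
  then show "l2_inner \<Omega> \<phi> (partial i \<psi>) = - l2_inner \<Omega> (partial i \<phi>) \<psi>" by simp
qed

text \<open>A test function supported in \<open>V\<close> meets \<open>u\<close> only where
  \<open>u\<close> is zero, so \<open>g\<close> annihilates all test functions of \<open>V\<close>.
  Taking \<open>V\<close> to be \<Omega> gives uniqueness of weak derivatives; taking the complement
  of a support gives orthogonality.\<close>

lemma has_weak_partial_local: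
  assumes g: "has_weak_partial \<Omega> i u g" and V: "open V" "V \<subseteq> \<Omega>" and u: "\<And>x. x \<in> V \<Longrightarrow> u x = 0"
  shows "AE x in lebesgue. x \<in> V \<longrightarrow> g x = 0"
proof (rule fundamental_lemma[OF V(1)])
  have gl: "l2_fun \<Omega> g" using g by (simp add: has_weak_partial_iff)
  \<comment> \<open>The product of \<open>g\<close> with the constant 1, which is square integrable
    on a bounded set.\<close>
  have "set_integrable lebesgue \<Omega> g"
    using l2_product_set_integrable[OF gl l2_fun_continuous[OF continuous_on_const, of 1]] by simp
  moreover have "V \<in> sets lebesgue" using V(1) by (simp add: borel_open)
  ultimately show "set_integrable lebesgue V g" using V(2) by (rule set_integrable_subset)
  fix \<phi> assume \<phi>: "\<phi> \<in> test_functions V"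
  obtain K where K: "compact K" "K \<subseteq> V" "\<forall>x. x \<notin> K \<longrightarrow> \<phi> x = 0"
    using test_functions_support[OF \<phi>] by blast
  have "\<phi> \<in> test_functions \<Omega>" using \<phi> test_functions_mono V(2) by blast
  then have "l2_inner \<Omega> g \<phi> = - l2_inner \<Omega> u (partial i \<phi>)"
    using g by (simp add: has_weak_partial_iff)
  also have "zext u x * zext (partial i \<phi>) x = 0" for x
    using u K partial_zero_outside[OF K(1,3), of x i] by (cases "x \<in> K") (auto simp: zext_def)
  then have "l2_inner \<Omega> u (partial i \<phi>) = 0"
    unfolding l2_inner_eq by (simp only: Bochner_Integration.integral_zero)
  finally have "l2_inner \<Omega> g \<phi> = 0" by simp
  moreover have "l2_inner \<Omega> g \<phi> = (LINT x:V|lebesgue. g x * \<phi> x)"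
    unfolding l2_inner_def set_lebesgue_integral_def
    using K V(2) by (intro Bochner_Integration.integral_cong) (auto simp: indicator_def)
  ultimately show "(LINT x:V|lebesgue. g x * \<phi> x) = 0" by simp
qed

text \<open>\<open>g - h\<close> is a weak derivative of \<open>u - u\<close>, the zero function, so
  locality applies on all of \<Omega>.\<close>

lemma has_weak_partial_unique:
  assumes "has_weak_partial \<Omega> i u g" "has_weak_partial \<Omega> i u h" "l2_fun \<Omega> u"
  shows "AE x in lebesgue. x \<in> \<Omega> \<longrightarrow> g x = h x"
proof -
  have "has_weak_partial \<Omega> i (\<lambda>x. u x + (-1) * u x) (\<lambda>x. g x + (-1) * h x)"
    using assms by (intro has_weak_partial_add has_weak_partial_cmult l2_fun_cmult)
  then have "AE x in lebesgue. x \<in> \<Omega> \<longrightarrow> g x + (-1) * h x = 0"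
    by (rule has_weak_partial_local) (auto simp: open_dom)
  then show ?thesis by eventually_elim auto
qed

lemma H1_l2: "u \<in> H1 \<Omega> \<Longrightarrow> l2_fun \<Omega> u"
  unfolding H1_def by blast

lemma weak_partial_works:
  assumes "u \<in> H1 \<Omega>"
  shows "has_weak_partial \<Omega> i u (weak_partial \<Omega> i u)"
proof -
  have "\<exists>g. has_weak_partial \<Omega> i u g" using assms unfolding H1_def by blast
  then show ?thesis unfolding weak_partial_def by (rule someI_ex)
qed

lemma weak_partial_l2: "u \<in> H1 \<Omega> \<Longrightarrow> l2_fun \<Omega> (weak_partial \<Omega> i u)"
  using weak_partial_works has_weak_partial_iff by blast

lemma H1_add: "u \<in> H1 \<Omega> \<Longrightarrow> v \<in> H1 \<Omega> \<Longrightarrow> (\<lambda>x. u x + v x) \<in> H1 \<Omega>"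
  unfolding H1_def using has_weak_partial_add l2_fun_add by blast

lemma H1_cmult: "u \<in> H1 \<Omega> \<Longrightarrow> (\<lambda>x. c * u x) \<in> H1 \<Omega>"
  unfolding H1_def using has_weak_partial_cmult l2_fun_cmult by blast

lemma H1_test_function: "\<phi> \<in> test_functions \<Omega> \<Longrightarrow> \<phi> \<in> H1 \<Omega>"
  unfolding H1_def using has_weak_partial_test_function test_function_l2 by blast

text \<open>The choice made by \<open>SOME\<close> need not respect sums pointwise. Both sides are
  weak derivatives of one function, hence equal almost everywhere, which is all that inner products
  see.\<close>

lemma weak_partial_add:
  assumes "u \<in> H1 \<Omega>" "v \<in> H1 \<Omega>"
  shows "AE x in lebesgue. x \<in> \<Omega> \<longrightarrow>
    weak_partial \<Omega> i (\<lambda>x. u x + v x) x = weak_partial \<Omega> i u x + weak_partial \<Omega> i v x"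
  using assms
  by (intro has_weak_partial_unique[OF weak_partial_works has_weak_partial_add] l2_fun_add)
    (auto intro: H1_add weak_partial_works H1_l2)

lemma weak_partial_cmult:
  assumes "u \<in> H1 \<Omega>"
  shows "AE x in lebesgue. x \<in> \<Omega> \<longrightarrow> weak_partial \<Omega> i (\<lambda>x. c * u x) x = c * weak_partial \<Omega> i u x"
  using assms
  by (intro has_weak_partial_unique[OF weak_partial_works has_weak_partial_cmult] l2_fun_cmult)
    (auto intro: H1_cmult weak_partial_works H1_l2)

lemma weak_partial_inner_add:
  assumes "u \<in> H1 \<Omega>" "v \<in> H1 \<Omega>" "l2_fun \<Omega> w"
  shows "l2_inner \<Omega> (weak_partial \<Omega> i (\<lambda>x. u x + v x)) w
    = l2_inner \<Omega> (weak_partial \<Omega> i u) w + l2_inner \<Omega> (weak_partial \<Omega> i v) w"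
  using l2_inner_cong_AE[OF weak_partial_l2[OF H1_add[OF assms(1,2)]]
      l2_fun_add[OF assms(1,2)[THEN weak_partial_l2]] assms(3) weak_partial_add[OF assms(1,2)]]
  by (simp add: l2_inner_add_left assms weak_partial_l2)

lemma weak_partial_inner_cmult:
  assumes "u \<in> H1 \<Omega>" "l2_fun \<Omega> w"
  shows "l2_inner \<Omega> (weak_partial \<Omega> i (\<lambda>x. c * u x)) w = c * l2_inner \<Omega> (weak_partial \<Omega> i u) w"
  using l2_inner_cong_AE[OF weak_partial_l2[OF H1_cmult[OF assms(1)]]
      l2_fun_cmult[OF weak_partial_l2[OF assms(1)]] assms(2) weak_partial_cmult[OF assms(1)]]
  by (simp add: l2_inner_cmult_left)

section \<open>The energy form, the H1 norm and the space \<open>H10\<close>\<close>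

lemma energy_eq:
  "energy \<Theta> \<Omega> u v = (\<Sum>i\<in>UNIV. \<Sum>j\<in>UNIV.
     \<Theta> $ i $ j * l2_inner \<Omega> (weak_partial \<Omega> j u) (weak_partial \<Omega> i v))"
  unfolding energy_def l2_inner_def by (simp add: mult.assoc)

lemma energy_commute:
  assumes "transpose \<Theta> = \<Theta>"
  shows "energy \<Theta> \<Omega> u v = energy \<Theta> \<Omega> v u"
proof -
  have "\<Theta> $ i $ j = \<Theta> $ j $ i" for i j
    using assms by (metis transpose_def vec_lambda_beta)
  then have "energy \<Theta> \<Omega> u v = (\<Sum>i\<in>UNIV. \<Sum>j\<in>UNIV.
     \<Theta> $ j $ i * l2_inner \<Omega> (weak_partial \<Omega> i v) (weak_partial \<Omega> j u))"
    unfolding energy_eq by (simp add: l2_inner_commute)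
  also have "\<dots> = energy \<Theta> \<Omega> v u" unfolding energy_eq by (rule sum.swap)
  finally show ?thesis .
qed

lemma energy_add_left:
  "u \<in> H1 \<Omega> \<Longrightarrow> v \<in> H1 \<Omega> \<Longrightarrow> w \<in> H1 \<Omega> \<Longrightarrow>
    energy \<Theta> \<Omega> (\<lambda>x. u x + v x) w = energy \<Theta> \<Omega> u w + energy \<Theta> \<Omega> v w"
  unfolding energy_eq by (simp add: weak_partial_inner_add weak_partial_l2 distrib_left sum.distrib)

lemma energy_cmult_left:
  "u \<in> H1 \<Omega> \<Longrightarrow> w \<in> H1 \<Omega> \<Longrightarrow> energy \<Theta> \<Omega> (\<lambda>x. c * u x) w = c * energy \<Theta> \<Omega> u w"
  unfolding energy_eq
  by (simp add: weak_partial_inner_cmult weak_partial_l2 sum_distrib_left mult.left_commute)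

text \<open>Off its support a function has zero weak gradient almost everywhere, so at almost every
  point one factor of each product vanishes.\<close>

lemma energy_disjoint_supports:
  assumes u: "u \<in> H1 \<Omega>" and v: "v \<in> H1 \<Omega>" and disj: "supp_in \<Omega> u \<inter> supp_in \<Omega> v = {}"
  shows "energy \<Theta> \<Omega> u v = 0"
proof -
  have loc: "AE x in lebesgue. x \<in> \<Omega> - supp_in \<Omega> w \<longrightarrow> weak_partial \<Omega> i w x = 0"
    if "w \<in> H1 \<Omega>" for w i
  proof -
    \<comment> \<open>\<open>supp_in\<close> is closed relative to \<Omega>; this form exhibits its
      complement in \<Omega> as open, as locality requires.\<close>
    have eq: "\<Omega> - supp_in \<Omega> w = \<Omega> - closure {x\<in>\<Omega>. w x \<noteq> 0}" unfolding supp_in_def by auto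
    show ?thesis
    proof (rule has_weak_partial_local[OF weak_partial_works[OF that]])
      show "open (\<Omega> - supp_in \<Omega> w)" unfolding eq by (intro open_Diff open_dom closed_closure)
      show "w x = 0" if "x \<in> \<Omega> - supp_in \<Omega> w" for x
        using that closure_subset[of "{x\<in>\<Omega>. w x \<noteq> 0}"] unfolding eq by blast
    qed blast
  qed
  have "l2_inner \<Omega> (weak_partial \<Omega> j u) (weak_partial \<Omega> i v) = 0" for i j
    unfolding l2_inner_eq
  proof (rule integral_eq_zero_AE)
    show "AE x in lebesgue. zext (weak_partial \<Omega> j u) x * zext (weak_partial \<Omega> i v) x = 0"
      using loc[OF u, of j] loc[OF v, of i]
      by eventually_elim (use disj in \<open>auto simp: zext_def indicator_def\<close>)
  qed
  then show ?thesis unfolding energy_eq by simp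
qed

lemma h1_norm_power2: "(h1_norm \<Omega> u)\<^sup>2 = l2_inner \<Omega> u u +
     (\<Sum>i\<in>UNIV. l2_inner \<Omega> (weak_partial \<Omega> i u) (weak_partial \<Omega> i u))"
  unfolding h1_norm_def by (intro real_sqrt_pow2 add_nonneg_nonneg sum_nonneg l2_inner_self_nonneg)

lemma h1_norm_nonneg: "0 \<le> h1_norm \<Omega> u"
  unfolding h1_norm_def by (intro real_sqrt_ge_zero add_nonneg_nonneg sum_nonneg l2_inner_self_nonneg)

text \<open>The parallelogram bound summed over the function and its weak derivatives. In
  \<open>H10_add\<close> two errors below \<open>\<epsilon> / 2\<close> then combine to one below
  \<open>\<epsilon>\<close>, since
  \<open>4 * (\<epsilon> / 2)\<^sup>2 = \<epsilon>\<^sup>2\<close>.\<close>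

lemma h1_norm_add_le:
  assumes "u \<in> H1 \<Omega>" "v \<in> H1 \<Omega>"
  shows "(h1_norm \<Omega> (\<lambda>x. u x + v x))\<^sup>2 \<le> 2 * (h1_norm \<Omega> u)\<^sup>2 + 2 * (h1_norm \<Omega> v)\<^sup>2"
proof -
  have "l2_inner \<Omega> (weak_partial \<Omega> i (\<lambda>x. u x + v x)) (weak_partial \<Omega> i (\<lambda>x. u x + v x))
      \<le> 2 * l2_inner \<Omega> (weak_partial \<Omega> i u) (weak_partial \<Omega> i u)
        + 2 * l2_inner \<Omega> (weak_partial \<Omega> i v) (weak_partial \<Omega> i v)" (is "?l \<le> _") for i
  proof -
    let ?s = "\<lambda>x. weak_partial \<Omega> i u x + weak_partial \<Omega> i v x"
    note l = weak_partial_l2[OF H1_add[OF assms], of i] l2_fun_add[OF assms[THEN weak_partial_l2[of _ i]]]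
    note ae = weak_partial_add[OF assms, of i]
    have "?l = l2_inner \<Omega> ?s (weak_partial \<Omega> i (\<lambda>x. u x + v x))"
      by (rule l2_inner_cong_AE[OF l l(1) ae])
    also have "\<dots> = l2_inner \<Omega> (weak_partial \<Omega> i (\<lambda>x. u x + v x)) ?s" by (rule l2_inner_commute)
    also have "\<dots> = l2_inner \<Omega> ?s ?s" by (rule l2_inner_cong_AE[OF l l(2) ae])
    also have "\<dots> \<le> 2 * l2_inner \<Omega> (weak_partial \<Omega> i u) (weak_partial \<Omega> i u)
        + 2 * l2_inner \<Omega> (weak_partial \<Omega> i v) (weak_partial \<Omega> i v)"
      by (intro l2_inner_add_self_le weak_partial_l2 assms)
    finally show ?thesis .
  qed
  then have "(\<Sum>i\<in>UNIV. l2_inner \<Omega> (weak_partial \<Omega> i (\<lambda>x. u x + v x)) (weak_partial \<Omega> i (\<lambda>x. u x + v x)))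
      \<le> (\<Sum>i\<in>UNIV. 2 * l2_inner \<Omega> (weak_partial \<Omega> i u) (weak_partial \<Omega> i u)
        + 2 * l2_inner \<Omega> (weak_partial \<Omega> i v) (weak_partial \<Omega> i v))"
    by (intro sum_mono)
  then show ?thesis
    using l2_inner_add_self_le[OF assms[THEN H1_l2]]
    by (simp add: h1_norm_power2 sum.distrib sum_distrib_left[symmetric] distrib_left)
qed

lemma h1_norm_cmult:
  assumes "u \<in> H1 \<Omega>"
  shows "h1_norm \<Omega> (\<lambda>x. c * u x) = \<bar>c\<bar> * h1_norm \<Omega> u"
proof -
  note l = weak_partial_l2[OF assms] weak_partial_l2[OF H1_cmult[OF assms, of c]]
  have "l2_inner \<Omega> (weak_partial \<Omega> i (\<lambda>x. c * u x)) (weak_partial \<Omega> i (\<lambda>x. c * u x))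
      = c\<^sup>2 * l2_inner \<Omega> (weak_partial \<Omega> i u) (weak_partial \<Omega> i u)" for i
    using weak_partial_inner_cmult[OF assms l(2)[of i], of i c]
      weak_partial_inner_cmult[OF assms l(1)[of i], of i c]
      l2_inner_commute[of "weak_partial \<Omega> i u" "weak_partial \<Omega> i (\<lambda>x. c * u x)"]
    by (simp add: power2_eq_square)
  moreover have "l2_inner \<Omega> (\<lambda>x. c * u x) (\<lambda>x. c * u x) = c\<^sup>2 * l2_inner \<Omega> u u"
    using l2_inner_cmult_left[of c u "\<lambda>x. c * u x"] l2_inner_cmult_left[of c u u]
      l2_inner_commute[of u "\<lambda>x. c * u x"] by (simp add: power2_eq_square)
  ultimately have "(h1_norm \<Omega> (\<lambda>x. c * u x))\<^sup>2 = (\<bar>c\<bar> * h1_norm \<Omega> u)\<^sup>2"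
    by (simp add: h1_norm_power2 sum_distrib_left[symmetric] distrib_left power_mult_distrib)
  then show ?thesis by (simp add: h1_norm_nonneg power2_eq_iff_nonneg)
qed

lemma H10_H1: "u \<in> H10 \<Omega> \<Longrightarrow> u \<in> H1 \<Omega>"
  unfolding H10_def by blast

lemma H10_zero: "(\<lambda>x. 0) \<in> H10 \<Omega>"
proof -
  have z: "(\<lambda>x. 0) \<in> H1 \<Omega>" by (rule H1_test_function[OF test_functions_zero])
  have "h1_norm \<Omega> (\<lambda>x. 0 - 0) = 0" using h1_norm_cmult[OF z, of 0] by simp
  then show ?thesis unfolding H10_def using z test_functions_zero by force
qed

lemma H10_add:
  assumes "u \<in> H10 \<Omega>" "v \<in> H10 \<Omega>"
  shows "(\<lambda>x. u x + v x) \<in> H10 \<Omega>"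
  unfolding H10_def
proof (safe intro!: H1_add assms[THEN H10_H1])
  fix \<epsilon> :: real assume "0 < \<epsilon>"
  then obtain \<phi> \<psi> where \<phi>: "\<phi> \<in> test_functions \<Omega>" "h1_norm \<Omega> (\<lambda>x. u x - \<phi> x) < \<epsilon> / 2"
    and \<psi>: "\<psi> \<in> test_functions \<Omega>" "h1_norm \<Omega> (\<lambda>x. v x - \<psi> x) < \<epsilon> / 2"
    using assms half_gt_zero[OF \<open>0 < \<epsilon>\<close>] unfolding H10_def by blast
  have diff: "(\<lambda>x. w x - \<eta> x) \<in> H1 \<Omega>" if "w \<in> H10 \<Omega>" "\<eta> \<in> test_functions \<Omega>" for w \<eta>
    using H1_add[OF H10_H1[OF that(1)] H1_cmult[OF H1_test_function[OF that(2)], of "-1"]] by simp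
  have "(h1_norm \<Omega> (\<lambda>x. (u x - \<phi> x) + (v x - \<psi> x)))\<^sup>2
      \<le> 2 * (h1_norm \<Omega> (\<lambda>x. u x - \<phi> x))\<^sup>2 + 2 * (h1_norm \<Omega> (\<lambda>x. v x - \<psi> x))\<^sup>2"
    using assms \<phi> \<psi> by (intro h1_norm_add_le diff)
  also have "\<dots> < 2 * (\<epsilon> / 2)\<^sup>2 + 2 * (\<epsilon> / 2)\<^sup>2"
    using \<phi>(2) \<psi>(2) h1_norm_nonneg by (intro add_strict_mono mult_strict_left_mono power_strict_mono) auto
  also have "\<dots> = \<epsilon>\<^sup>2" by (simp add: power2_eq_square)
  finally have "h1_norm \<Omega> (\<lambda>x. (u x - \<phi> x) + (v x - \<psi> x)) < \<epsilon>"
    using \<open>0 < \<epsilon>\<close> by (intro power2_less_imp_less[of _ \<epsilon>]) auto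
  moreover have "(\<lambda>x. (u x - \<phi> x) + (v x - \<psi> x)) = (\<lambda>x. u x + v x - (\<phi> x + \<psi> x))" by auto
  ultimately show "\<exists>\<eta>\<in>test_functions \<Omega>. h1_norm \<Omega> (\<lambda>x. u x + v x - \<eta> x) < \<epsilon>"
    using test_functions_add[OF \<phi>(1) \<psi>(1)] by (intro bexI[of _ "\<lambda>x. \<phi> x + \<psi> x"]) auto
qed

lemma H10_cmult:
  assumes "u \<in> H10 \<Omega>"
  shows "(\<lambda>x. c * u x) \<in> H10 \<Omega>"
  unfolding H10_def
proof (safe intro!: H1_cmult assms[THEN H10_H1])
  fix \<epsilon> :: real assume "0 < \<epsilon>"
  \<comment> \<open>Adding 1 keeps the divisor positive when \<open>c = 0\<close>.\<close>
  then have "0 < \<epsilon> / (\<bar>c\<bar> + 1)" by simp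
  then obtain \<phi> where \<phi>: "\<phi> \<in> test_functions \<Omega>" "h1_norm \<Omega> (\<lambda>x. u x - \<phi> x) < \<epsilon> / (\<bar>c\<bar> + 1)"
    using assms unfolding H10_def by blast
  have "(\<lambda>x. u x - \<phi> x) \<in> H1 \<Omega>"
    using H1_add[OF H10_H1[OF assms] H1_cmult[OF H1_test_function[OF \<phi>(1)], of "-1"]] by simp
  then have "h1_norm \<Omega> (\<lambda>x. c * (u x - \<phi> x)) = \<bar>c\<bar> * h1_norm \<Omega> (\<lambda>x. u x - \<phi> x)"
    by (rule h1_norm_cmult)
  also have "\<dots> \<le> (\<bar>c\<bar> + 1) * h1_norm \<Omega> (\<lambda>x. u x - \<phi> x)"
    using h1_norm_nonneg by (intro mult_right_mono) auto
  also have "\<dots> < \<epsilon>" using \<phi>(2) by (simp add: pos_less_divide_eq mult.commute)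
  finally have "h1_norm \<Omega> (\<lambda>x. c * u x - c * \<phi> x) < \<epsilon>" by (simp add: right_diff_distrib)
  then show "\<exists>\<eta>\<in>test_functions \<Omega>. h1_norm \<Omega> (\<lambda>x. c * u x - \<eta> x) < \<epsilon>"
    using test_functions_cmult[OF \<phi>(1)] by (intro bexI[of _ "\<lambda>x. c * \<phi> x"]) auto
qed

end

section \<open>Finite element spaces\<close>

text \<open>\<Omega> is the interior of a compact union of polytopes, hence bounded and equal to the
  interior of its closure. The latter rules out slits and places the interiors of mesh elements,
  which cover the closure, inside \<Omega>.\<close>

lemma polygonal_domain_regular:
  assumes "polygonal_domain \<Omega>"
  shows "bounded_open \<Omega>" "interior (closure \<Omega>) \<subseteq> \<Omega>"
proof -
  obtain \<P> where P: "finite \<P>" "\<And>P. P \<in> \<P> \<Longrightarrow> polytope P" "\<Omega> = interior (\<Union>\<P>)"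
    using assms unfolding polygonal_domain_def by blast
  have cpt: "compact (\<Union>\<P>)" using P by (intro compact_Union) (auto intro: polytope_imp_compact)
  then have "bounded \<Omega>"
    using compact_imp_bounded bounded_subset interior_subset P(3) by metis
  then show "bounded_open \<Omega>" using P(3) by unfold_locales auto
  have "closure \<Omega> \<subseteq> \<Union>\<P>"
    using cpt P(3) by (simp add: closure_minimal compact_imp_closed interior_subset)
  then show "interior (closure \<Omega>) \<subseteq> \<Omega>" using P(3) interior_mono by metis
qed

lemma full_simplex_interior:
  fixes S :: "(real^'n::finite) set"
  assumes "int CARD('n) simplex S"
  shows "interior S \<noteq> {}"
proof -
  have d: "aff_dim S = int DIM(real^'n)" using aff_dim_simplex[OF assms] by simp
  then have "affine hull S = UNIV" using aff_dim_eq_full by blast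
  then have "interior S = rel_interior S" by (rule rel_interior_interior[symmetric])
  moreover have "convex S" using assms unfolding simplex_def by auto
  moreover have "S \<noteq> {}" using d by auto
  ultimately show ?thesis by (simp add: rel_interior_eq_empty)
qed

locale fem_mesh = bounded_open \<Omega> for \<Omega> :: "(real^'n::finite) set" +
  fixes \<T> :: "(real^'n) set set"
  assumes interior_closure_dom: "interior (closure \<Omega>) \<subseteq> \<Omega>" and is_mesh: "mesh \<Omega> \<T>"
begin

lemma element_interior:
  assumes "\<tau> \<in> \<T>"
  shows "interior \<tau> \<noteq> {}" "interior \<tau> \<subseteq> \<Omega>"
proof -
  show "interior \<tau> \<noteq> {}" using assms is_mesh full_simplex_interior unfolding mesh_def by blast
  have "\<tau> \<subseteq> closure \<Omega>" using assms is_mesh unfolding mesh_def by blast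
  then show "interior \<tau> \<subseteq> \<Omega>" using interior_mono interior_closure_dom by blast
qed

lemma fem_H1: "v \<in> fem_space \<Omega> \<T> \<Longrightarrow> v \<in> H1 \<Omega>"
  unfolding fem_space_def using H10_H1 by blast

lemma fem_affine:
  assumes "v \<in> fem_space \<Omega> \<T>" "\<tau> \<in> \<T>"
  shows "\<exists>c b. \<forall>x\<in>\<tau> \<inter> \<Omega>. v x = c \<bullet> x + b"
  using assms unfolding fem_space_def by blast

lemma fem_subspace: "fun_subspace (fem_space \<Omega> \<T>)"
  unfolding fun_subspace_def zero_fun_def plus_fun_def
proof (intro conjI ballI allI)
  have "\<exists>c b. \<forall>x\<in>\<tau> \<inter> \<Omega>. 0 = c \<bullet> x + b" for \<tau> :: "(real^'n) set"
    by (intro exI[of _ 0]) simp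
  then show "(\<lambda>x. 0) \<in> fem_space \<Omega> \<T>" unfolding fem_space_def by (simp add: H10_zero)
next
  fix u v assume uv: "u \<in> fem_space \<Omega> \<T>" "v \<in> fem_space \<Omega> \<T>"
  have "\<exists>c b. \<forall>x\<in>\<tau> \<inter> \<Omega>. u x + v x = c \<bullet> x + b" if \<tau>: "\<tau> \<in> \<T>" for \<tau>
  proof -
    obtain c b where c: "\<forall>x\<in>\<tau> \<inter> \<Omega>. u x = c \<bullet> x + b"
      using fem_affine[OF uv(1) \<tau>] by blast
    obtain c' b' where c': "\<forall>x\<in>\<tau> \<inter> \<Omega>. v x = c' \<bullet> x + b'"
      using fem_affine[OF uv(2) \<tau>] by blast
    show ?thesis using c c' by (intro exI[of _ "c + c'"] exI[of _ "b + b'"]) (simp add: inner_add_left)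
  qed
  then show "(\<lambda>x. u x + v x) \<in> fem_space \<Omega> \<T>"
    using uv H10_add unfolding fem_space_def by simp
next
  fix k u assume u: "u \<in> fem_space \<Omega> \<T>"
  have "\<exists>c b. \<forall>x\<in>\<tau> \<inter> \<Omega>. k * u x = c \<bullet> x + b" if \<tau>: "\<tau> \<in> \<T>" for \<tau>
  proof -
    obtain c b where c: "\<forall>x\<in>\<tau> \<inter> \<Omega>. u x = c \<bullet> x + b"
      using fem_affine[OF u \<tau>] by blast
    show ?thesis using c by (intro exI[of _ "k *\<^sub>R c"] exI[of _ "k * b"]) (simp add: distrib_left)
  qed
  then show "(\<lambda>x. k * u x) \<in> fem_space \<Omega> \<T>"
    using u H10_cmult unfolding fem_space_def by simp
qed

text \<open>An affine function is determined by its values at a point and its translates in the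
  coordinate directions.\<close>

lemma fem_determining_points:
  obtains X where "finite X" "X \<subseteq> (\<Union>\<tau>\<in>\<T>. interior \<tau>)"
    "\<And>v. v \<in> fem_space \<Omega> \<T> \<Longrightarrow> (\<forall>x\<in>X. v x = 0) \<Longrightarrow> v = 0"
proof -
  \<comment> \<open>Interior points rather than vertices: the affine formula holds on
    \<open>\<tau> \<inter> \<Omega>\<close>, and vertices may lie on the boundary. Interiors are
    also where \<open>fem_l2_pos\<close> first obtains zero values.\<close>
  have "\<exists>z r. 0 < r \<and> ball z r \<subseteq> interior \<tau>" if "\<tau> \<in> \<T>" for \<tau>
    using element_interior(1)[OF that] open_interior open_contains_ball by (metis ex_in_conv)
  then obtain z r where zr: "\<And>\<tau>. \<tau> \<in> \<T> \<Longrightarrow> 0 < r \<tau> \<and> ball (z \<tau>) (r \<tau>) \<subseteq> interior \<tau>"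
    by metis
  define y where "y \<tau> i = z \<tau> + (r \<tau> / 2) *\<^sub>R axis i 1" for \<tau> and i :: 'n
  define X where "X = (\<Union>\<tau>\<in>\<T>. insert (z \<tau>) (range (y \<tau>)))"
  have ins: "z \<tau> \<in> interior \<tau>" "y \<tau> i \<in> interior \<tau>" if "\<tau> \<in> \<T>" for \<tau> i
  proof -
    have "z \<tau> \<in> ball (z \<tau>) (r \<tau>)" "y \<tau> i \<in> ball (z \<tau>) (r \<tau>)"
      using zr[OF that] by (auto simp: y_def dist_norm)
    then show "z \<tau> \<in> interior \<tau>" "y \<tau> i \<in> interior \<tau>" using zr[OF that] by auto
  qed
  have "finite \<T>" using is_mesh unfolding mesh_def triangulation_def by blast
  then have "finite X" unfolding X_def by simp
  moreover have "X \<subseteq> (\<Union>\<tau>\<in>\<T>. interior \<tau>)" unfolding X_def using ins by blast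
  moreover have "v = 0" if v: "v \<in> fem_space \<Omega> \<T>" "\<forall>x\<in>X. v x = 0" for v
  proof
    fix x
    show "v x = 0 x"
    proof (cases "x \<in> \<Omega>")
      case False
      then show ?thesis using v(1) unfolding fem_space_def by simp
    next
      case True
      then have "x \<in> \<Union>\<T>" using is_mesh closure_subset unfolding mesh_def by blast
      then obtain \<tau> where \<tau>: "\<tau> \<in> \<T>" "x \<in> \<tau>" by blast
      obtain c b where c: "\<forall>x\<in>\<tau> \<inter> \<Omega>. v x = c \<bullet> x + b"
      using fem_affine[OF v(1) \<tau>(1)] by blast
      have pts: "z \<tau> \<in> \<tau> \<inter> \<Omega>" "y \<tau> i \<in> \<tau> \<inter> \<Omega>" "z \<tau> \<in> X" "y \<tau> i \<in> X" for i
        using ins[OF \<tau>(1)] element_interior(2)[OF \<tau>(1)] interior_subset \<tau>(1) unfolding X_def by blast+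
      have "c \<bullet> w + b = 0" if "w \<in> \<tau> \<inter> \<Omega>" "w \<in> X" for w
        using bspec[OF c that(1)] bspec[OF v(2) that(2)] by simp
      then have zero: "c \<bullet> z \<tau> + b = 0" "c \<bullet> y \<tau> i + b = 0" for i
        using pts by blast+
      have "c $ i = 0" for i
      proof -
        have "c \<bullet> y \<tau> i = c \<bullet> z \<tau> + (r \<tau> / 2) * (c $ i)"
          unfolding y_def by (simp add: inner_add_right inner_axis)
        then have "(r \<tau> / 2) * (c $ i) = 0" using zero(1) zero(2)[of i] by linarith
        then show ?thesis using zr[OF \<tau>(1)] by simp
      qed
      then have "c = 0" by (simp add: vec_eq_iff)
      then show ?thesis using zero(1) c \<tau>(2) True by simp
    qed
  qed
  ultimately show thesis using that by blast
qed

text \<open>A zero L2 norm only gives zero almost everywhere. Inside an element the nonzero set of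
  an affine function is open, and a nonempty open set is not negligible; so \<open>v\<close>
  vanishes in all element interiors, which contain a determining set.\<close>

lemma fem_l2_pos:
  assumes v: "v \<in> fem_space \<Omega> \<T>" and nz: "v \<noteq> 0"
  shows "0 < l2_inner \<Omega> v v"
proof (rule ccontr)
  assume "\<not> ?thesis"
  then have "l2_inner \<Omega> v v = 0" using l2_inner_self_nonneg[of v] by linarith
  moreover have "l2_fun \<Omega> v" using v fem_H1 H1_l2 by blast
  ultimately have "AE x in lebesgue. zext v x * zext v x = 0"
    unfolding l2_inner_eq using l2_product_integrable[of v v]
    by (subst (asm) integral_nonneg_eq_0_iff_AE) auto
  then obtain N where N: "N \<in> null_sets lebesgue" "{x. zext v x \<noteq> 0} \<subseteq> N"
    by (auto simp: eventually_ae_filter)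
  have zero: "v x = 0" if \<tau>: "\<tau> \<in> \<T>" "x \<in> interior \<tau>" for \<tau> x
  proof (rule ccontr)
    assume vx: "v x \<noteq> 0"
    obtain c b where c: "\<forall>x\<in>\<tau> \<inter> \<Omega>. v x = c \<bullet> x + b"
      using fem_affine[OF v \<tau>(1)] by blast
    have int: "interior \<tau> \<subseteq> \<tau> \<inter> \<Omega>" using element_interior(2)[OF \<tau>(1)] interior_subset by blast
    let ?U = "interior \<tau> \<inter> {x. c \<bullet> x + b \<noteq> 0}"
    have "open ?U"
      by (intro open_Int open_interior open_Collect_neq continuous_intros)
    moreover have "?U \<subseteq> N"
    proof
      fix w assume w: "w \<in> ?U"
      then have "w \<in> \<tau> \<inter> \<Omega>" using int by blast
      then have "zext v w = c \<bullet> w + b" using c by (simp add: zext_def)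
      then show "w \<in> N" using N(2) w by auto
    qed
    then have "negligible ?U" using N(1) negligible_iff_null_sets negligible_subset by blast
    moreover have "x \<in> \<tau> \<inter> \<Omega>" using int \<tau>(2) by blast
    then have "x \<in> ?U" using \<tau>(2) vx c by simp
    ultimately show False using open_not_negligible by blast
  qed
  obtain X where "X \<subseteq> (\<Union>\<tau>\<in>\<T>. interior \<tau>)"
    "\<And>v. v \<in> fem_space \<Omega> \<T> \<Longrightarrow> (\<forall>x\<in>X. v x = 0) \<Longrightarrow> v = 0"
    using fem_determining_points by metis
  then show False using zero nz v by blast
qed

lemma fem_finite_points:
  "\<exists>X. finite X \<and> (\<forall>v\<in>fem_space \<Omega> \<T>. (\<forall>x\<in>X. v x = 0) \<longrightarrow> v = 0)"
  using fem_determining_points by metis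

lemma l2_inner_product_space: "inner_product_space (fem_space \<Omega> \<T>) (l2_inner \<Omega>)"
proof
  fix u v w assume "u \<in> fem_space \<Omega> \<T>" "v \<in> fem_space \<Omega> \<T>" "w \<in> fem_space \<Omega> \<T>"
  then show "l2_inner \<Omega> (u + v) w = l2_inner \<Omega> u w + l2_inner \<Omega> v w"
    unfolding plus_fun_def by (intro l2_inner_add_left H1_l2 fem_H1)
qed (auto simp: fem_subspace fem_finite_points fem_l2_pos l2_inner_cmult_left intro: l2_inner_commute)

lemma energy_inner_product_space:
  assumes sym: "transpose \<Theta> = \<Theta>" and "0 < c"
    and coercive: "\<And>u. u \<in> fem_space \<Omega> \<T> \<Longrightarrow> c * (h1_norm \<Omega> u)\<^sup>2 \<le> energy \<Theta> \<Omega> u u"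
  shows "inner_product_space (fem_space \<Omega> \<T>) (energy \<Theta> \<Omega>)"
proof
  fix u v w assume m: "u \<in> fem_space \<Omega> \<T>" "v \<in> fem_space \<Omega> \<T>" "w \<in> fem_space \<Omega> \<T>"
  show "energy \<Theta> \<Omega> (u + v) w = energy \<Theta> \<Omega> u w + energy \<Theta> \<Omega> v w"
    unfolding plus_fun_def using m by (intro energy_add_left fem_H1)
next
  fix u w k assume m: "u \<in> fem_space \<Omega> \<T>" "w \<in> fem_space \<Omega> \<T>"
  show "energy \<Theta> \<Omega> (\<lambda>x. k * u x) w = k * energy \<Theta> \<Omega> u w"
    using m by (intro energy_cmult_left fem_H1)
next
  fix u assume u: "u \<in> fem_space \<Omega> \<T>" "u \<noteq> 0"
  have "0 < l2_inner \<Omega> u u" by (rule fem_l2_pos[OF u])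
  also have "\<dots> \<le> (h1_norm \<Omega> u)\<^sup>2"
    unfolding h1_norm_power2 by (simp add: sum_nonneg l2_inner_self_nonneg)
  finally have "0 < c * (h1_norm \<Omega> u)\<^sup>2" using \<open>0 < c\<close> by simp
  then show "0 < energy \<Theta> \<Omega> u u" using coercive[OF u(1)] by linarith
qed (auto simp: fem_subspace fem_finite_points intro: energy_commute[OF sym])

lemma supported_subspace:
  "fun_subspace {v \<in> fem_space \<Omega> \<T>. supp_in \<Omega> v \<subseteq> K}"
  unfolding fun_subspace_def
proof (intro conjI ballI allI)
  show "0 \<in> {v \<in> fem_space \<Omega> \<T>. supp_in \<Omega> v \<subseteq> K}"
    using fun_subspace_0[OF fem_subspace] by (simp add: supp_in_def)
next
  fix u v assume uv: "u \<in> {v \<in> fem_space \<Omega> \<T>. supp_in \<Omega> v \<subseteq> K}"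
    "v \<in> {v \<in> fem_space \<Omega> \<T>. supp_in \<Omega> v \<subseteq> K}"
  have "closure {x\<in>\<Omega>. (u + v) x \<noteq> 0} \<subseteq> closure ({x\<in>\<Omega>. u x \<noteq> 0} \<union> {x\<in>\<Omega>. v x \<noteq> 0})"
    by (intro closure_mono) auto
  then have "supp_in \<Omega> (u + v) \<subseteq> supp_in \<Omega> u \<union> supp_in \<Omega> v"
    unfolding supp_in_def closure_Un by blast
  then show "u + v \<in> {v \<in> fem_space \<Omega> \<T>. supp_in \<Omega> v \<subseteq> K}"
    using uv fun_subspace_add[OF fem_subspace] by blast
next
  fix c u assume u: "u \<in> {v \<in> fem_space \<Omega> \<T>. supp_in \<Omega> v \<subseteq> K}"
  have "closure {x\<in>\<Omega>. c * u x \<noteq> 0} \<subseteq> closure {x\<in>\<Omega>. u x \<noteq> 0}"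
    by (intro closure_mono) auto
  then have "supp_in \<Omega> (\<lambda>x. c * u x) \<subseteq> supp_in \<Omega> u" unfolding supp_in_def by blast
  then show "(\<lambda>x. c * u x) \<in> {v \<in> fem_space \<Omega> \<T>. supp_in \<Omega> v \<subseteq> K}"
    using u fun_subspace_scale[OF fem_subspace] by blast
qed

end

text \<open>\<open>T\<close> and \<open>T'\<close> agree only on \<open>V\<close>, so equality of
  the sweeps is proved together with the fact that the iterates stay in \<open>V\<close>.\<close>

lemma sweep_cong:
  assumes "\<And>i u. i \<le> n \<Longrightarrow> u \<in> V \<Longrightarrow> T i u = T' i u" "\<And>i u. i \<le> n \<Longrightarrow> u \<in> V \<Longrightarrow> id_minus (T' i) u \<in> V"
    and "u \<in> V"
  shows "sweep_asc T n u = sweep_asc T' n u \<and> sweep_asc T' n u \<in> V"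
    "sweep_desc T n u = sweep_desc T' n u \<and> sweep_desc T' n u \<in> V"
  using assms by (induction n arbitrary: u) (auto simp: id_minus_def)

text \<open>A new element lies inside an old one, on which the function is already affine.\<close>

lemma fem_space_refinement:
  assumes "midpoint_refinement \<T> \<T>'"
  shows "fem_space \<Omega> \<T> \<subseteq> fem_space \<Omega> \<T>'"
proof
  fix v assume v: "v \<in> fem_space \<Omega> \<T>"
  have "\<exists>c b. \<forall>x\<in>\<tau>' \<inter> \<Omega>. v x = c \<bullet> x + b" if \<tau>': "\<tau>' \<in> \<T>'" for \<tau>'
  proof -
    obtain \<tau> where "\<tau> \<in> \<T>" "\<tau>' \<subseteq> \<tau>" using assms \<tau>' unfolding midpoint_refinement_def by blast
    moreover from this obtain c b where "\<forall>x\<in>\<tau> \<inter> \<Omega>. v x = c \<bullet> x + b"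
      using v unfolding fem_space_def by blast
    ultimately show ?thesis by blast
  qed
  then show "v \<in> fem_space \<Omega> \<T>'" using v unfolding fem_space_def by blast
qed

lemma overlap_number_ge:
  assumes "i \<in> {1..p}"
  shows "card {j\<in>{1..p}. overlap_region \<Omega> h (D i) \<inter> overlap_region \<Omega> h (D j) \<noteq> {}}
    \<le> overlap_number \<Omega> h p D"
proof -
  have "card {j\<in>{1..p}. overlap_region \<Omega> h (D i) \<inter> overlap_region \<Omega> h (D j) \<noteq> {}}
      = (\<Sum>j=1..p. if overlap_region \<Omega> h (D i) \<inter> overlap_region \<Omega> h (D j) \<noteq> {} then 1 else 0)"
    by (simp add: sum.If_cases Int_def)
  also have "\<dots> \<le> overlap_number \<Omega> h p D"
    unfolding overlap_number_def using assms by (intro Max_ge) auto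
  finally show ?thesis .
qed

section \<open>The concrete multigrid setting as an instance of the abstract estimates\<close>

context
  fixes \<Theta> :: "real^'n^'n::finite" and \<Omega> :: "(real^'n) set"
    and \<sigma> h0 C\<Theta>1 C\<Theta>2 C0 g0 :: real
    and \<T> :: "nat \<Rightarrow> (real^'n) set set"
    and p m :: "nat \<Rightarrow> nat"
    and D :: "nat \<Rightarrow> nat \<Rightarrow> (real^'n) set" and J :: nat
  assumes setting: "multigrid_setting \<Theta> \<Omega> \<sigma> h0 \<T> p D m C\<Theta>1 C\<Theta>2 C0 g0 J"
begin

lemma setting_simps:
  "polygonal_domain \<Omega>" "transpose \<Theta> = \<Theta>" "0 < C\<Theta>1" "0 < C0"
  "k \<le> J \<Longrightarrow> mesh \<Omega> (\<T> k)"
  "k < J \<Longrightarrow> midpoint_refinement (\<T> k) (\<T> (Suc k))"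
  "k \<le> J \<Longrightarrow> u \<in> fem_space \<Omega> (\<T> k) \<Longrightarrow> C\<Theta>1 * (h1_norm \<Omega> u)\<^sup>2 \<le> energy \<Theta> \<Omega> u u"
  "k \<in> {1..J} \<Longrightarrow> 1 \<le> m k"
  "k \<in> {1..J} \<Longrightarrow> stable_decomposition (energy \<Theta> \<Omega>) (fem_space \<Omega> (\<T> k))
        (local_space \<Omega> h0 \<T> D k) (p k) C0"
  "k \<in> {1..J} \<Longrightarrow> real (overlap_number \<Omega> h0 (p k) (D k)) \<le> g0"
  using setting unfolding multigrid_setting_def by auto

lemma setting_mesh: "k \<le> J \<Longrightarrow> fem_mesh \<Omega> (\<T> k)"
  using polygonal_domain_regular[OF setting_simps(1)] setting_simps(5)
  by (intro fem_mesh.intro fem_mesh_axioms.intro)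

lemma setting_energy:
  assumes "k \<le> J"
  shows "inner_product_space (fem_space \<Omega> (\<T> k)) (energy \<Theta> \<Omega>)"
  by (rule fem_mesh.energy_inner_product_space[OF setting_mesh[OF assms] setting_simps(2,3)])
    (rule setting_simps(7)[OF assms])

lemma setting_nested:
  assumes "i \<le> k" "k \<le> J"
  shows "fem_space \<Omega> (\<T> i) \<subseteq> fem_space \<Omega> (\<T> k)"
  using assms
proof (induction k rule: dec_induct)
  case (step k)
  then have "fem_space \<Omega> (\<T> k) \<subseteq> fem_space \<Omega> (\<T> (Suc k))"
    by (intro fem_space_refinement setting_simps) auto
  then show ?case using step by auto
qed blast

lemma setting_local_space:
  assumes "k \<le> J"
  shows "fun_subspace (local_space \<Omega> h0 \<T> D k i)"
    "local_space \<Omega> h0 \<T> D k i \<subseteq> fem_space \<Omega> (\<T> k)"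
proof -
  interpret fem_mesh \<Omega> "\<T> k" by (rule setting_mesh[OF assms])
  interpret coarse: fem_mesh \<Omega> "\<T> 0" using setting_mesh[of 0] by simp
  show "fun_subspace (local_space \<Omega> h0 \<T> D k i)"
    unfolding local_space_def using coarse.fem_subspace supported_subspace by simp
  show "local_space \<Omega> h0 \<T> D k i \<subseteq> fem_space \<Omega> (\<T> k)"
    unfolding local_space_def using setting_nested[of 0 k] assms by auto
qed

lemma setting_g0_nonneg: "1 \<le> J \<Longrightarrow> 0 \<le> g0"
  using setting_simps(10)[of 1] of_nat_0_le_iff order_trans by fastforce

lemma setting_subspace_correction:
  assumes k: "k \<in> {1..J}"
  shows "subspace_correction (fem_space \<Omega> (\<T> k)) (energy \<Theta> \<Omega>) (local_space \<Omega> h0 \<T> D k) (p k) C0 g0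
    (\<lambda>i j. overlap_region \<Omega> h0 (D k i) \<inter> overlap_region \<Omega> h0 (D k j) \<noteq> {})"
proof -
  have kJ: "k \<le> J" "1 \<le> J" using k by auto
  interpret fem_mesh \<Omega> "\<T> k" by (rule setting_mesh[OF kJ(1)])
  show ?thesis
  proof (intro subspace_correction.intro subspace_correction_axioms.intro)
    show "inner_product_space (fem_space \<Omega> (\<T> k)) (energy \<Theta> \<Omega>)" by (rule setting_energy[OF kJ(1)])
    show "stable_decomposition (energy \<Theta> \<Omega>) (fem_space \<Omega> (\<T> k)) (local_space \<Omega> h0 \<T> D k) (p k) C0"
      by (rule setting_simps(9)[OF k])
  next
    fix i j u v
    assume ij: "i \<in> {1..p k}" "j \<in> {1..p k}"
      and disj: "\<not> overlap_region \<Omega> h0 (D k i) \<inter> overlap_region \<Omega> h0 (D k j) \<noteq> {}"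
      and u: "u \<in> local_space \<Omega> h0 \<T> D k i" and v: "v \<in> local_space \<Omega> h0 \<T> D k j"
    have "supp_in \<Omega> u \<subseteq> overlap_region \<Omega> h0 (D k i)" "supp_in \<Omega> v \<subseteq> overlap_region \<Omega> h0 (D k j)"
      using u v ij unfolding local_space_def by auto
    then have "supp_in \<Omega> u \<inter> supp_in \<Omega> v = {}" using disj by blast
    moreover have "u \<in> H1 \<Omega>" "v \<in> H1 \<Omega>"
      using u v setting_local_space(2)[OF kJ(1)] fem_H1 by blast+
    ultimately show "energy \<Theta> \<Omega> u v = 0" by (intro energy_disjoint_supports)
  next
    fix i assume "i \<in> {1..p k}"
    then show "real (card {j \<in> {1..p k}. overlap_region \<Omega> h0 (D k i) \<inter> overlap_region \<Omega> h0 (D k j) \<noteq> {}}) \<le> g0"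
      using overlap_number_ge[of i "p k" \<Omega> h0 "D k"] setting_simps(10)[OF k]
      by (meson of_nat_le_iff order_trans)
  qed (use setting_local_space[OF kJ(1)] setting_simps(4) setting_g0_nonneg[OF kJ(2)] in auto)
qed

text \<open>On the finite element space each correction operator is an energy projection, and
  \<open>id_minus\<close> of a projection preserves the space, so the factors can be replaced one by
  one.\<close>

lemma ssc_smoother_eq:
  assumes k: "k \<in> {1..J}" and v: "v \<in> fem_space \<Omega> (\<T> k)"
  shows "ssc_smoother \<Theta> \<Omega> h0 \<T> p D k v
    = symmetric_ssc (\<lambda>i. orth_proj (energy \<Theta> \<Omega>) (local_space \<Omega> h0 \<T> D k i)) (p k) v"
proof -
  let ?V = "fem_space \<Omega> (\<T> k)"
  interpret subspace_correction ?V "energy \<Theta> \<Omega>" "local_space \<Omega> h0 \<T> D k" "p k" C0 g0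
    "\<lambda>i j. overlap_region \<Omega> h0 (D k i) \<inter> overlap_region \<Omega> h0 (D k j) \<noteq> {}"
    by (rule setting_subspace_correction[OF k])
  have kJ: "k \<le> J" using k by simp
  let ?T = "\<lambda>i. correction_op (l2_inner \<Omega>) (energy \<Theta> \<Omega>) ?V (local_space \<Omega> h0 \<T> D k i)"
  have T: "?T i u = P i u" if "u \<in> ?V" for i u
    using correction_op_eq_orth_proj[OF fem_mesh.l2_inner_product_space[OF setting_mesh[OF kJ]]
      setting_energy[OF kJ] setting_local_space[OF kJ] that] .
  note asc = sweep_cong(1)[of "p k" ?V ?T P, OF T id_minus_P_mem]
    and desc = sweep_cong(2)[of "p k" ?V ?T P, OF T id_minus_P_mem]
  have I: "id_minus (?T 0) u = id_minus (P 0) u" if "u \<in> ?V" for u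
    using T[OF that] by (simp add: id_minus_def)
  define s where "s = sweep_asc P (p k) v"
  have s: "s \<in> ?V" "sweep_asc ?T (p k) v = s" unfolding s_def using asc v by auto
  have "(id_minus (?T 0) ^^ 2) s = (id_minus (P 0) ^^ 2) s" "(id_minus (P 0) ^^ 2) s \<in> ?V"
    using I s id_minus_P_mem by (auto simp: numeral_2_eq_2)
  then show ?thesis
    unfolding ssc_smoother_def symmetric_ssc_def using desc s by (simp add: s_def[symmetric])
qed

text \<open>Membership is carried along because bilinearity and projections are available only on
  the finite element space. At level 0 the operator is zero, and the factor 1 is the contraction
  that the next level asks for.\<close>

lemma multigrid_error_bound:
  assumes "k \<le> J" "v \<in> fem_space \<Omega> (\<T> k)"
  shows "multigrid_error \<Theta> \<Omega> h0 \<T> p D m k v \<in> fem_space \<Omega> (\<T> k)"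
    and "energy \<Theta> \<Omega> (multigrid_error \<Theta> \<Omega> h0 \<T> p D m k v) v
      \<le> (if k = 0 then 1 else mg_rate C0 g0 (m k)) * energy \<Theta> \<Omega> v v"
  using assms
proof (induction k arbitrary: v)
  case 0
  interpret inner_product_space "fem_space \<Omega> (\<T> 0)" "energy \<Theta> \<Omega>" by (rule setting_energy) simp
  case 1 show ?case using zero_mem by (simp add: multigrid_error_def zero_fun_def)
  case 2 then show ?case using zero_left nonneg by (simp add: multigrid_error_def zero_fun_def)
next
  case (Suc k)
  let ?V = "fem_space \<Omega> (\<T> (Suc k))" and ?U = "fem_space \<Omega> (\<T> k)"
  let ?E = "multigrid_error \<Theta> \<Omega> h0 \<T> p D m"
  have E_Suc: "?E (Suc k) = (ssc_smoother \<Theta> \<Omega> h0 \<T> p D (Suc k) ^^ m (Suc k)) \<circ>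
     id_minus (id_minus (?E k) \<circ> orth_proj (energy \<Theta> \<Omega>) ?U) \<circ>
     (ssc_smoother \<Theta> \<Omega> h0 \<T> p D (Suc k) ^^ m (Suc k))"
    unfolding multigrid_error_def by simp
  \<comment> \<open>The coarser rate is weakened to 1, so the bound at a level involves only its own
    number of smoothing steps.\<close>
  have contraction: "energy \<Theta> \<Omega> (?E k u) u \<le> energy \<Theta> \<Omega> u u" if "u \<in> ?U" "Suc k \<le> J" for u
  proof -
    interpret inner_product_space ?U "energy \<Theta> \<Omega>" using that by (intro setting_energy) simp
    have "(if k = 0 then 1 else mg_rate C0 g0 (m k)) \<le> 1"
      using mg_rate_bounds(1)[OF setting_simps(4) setting_g0_nonneg] that(2) by auto
    then have "(if k = 0 then 1 else mg_rate C0 g0 (m k)) * energy \<Theta> \<Omega> u u \<le> 1 * energy \<Theta> \<Omega> u u"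
      by (rule mult_right_mono) (rule nonneg[OF that(1)])
    then show ?thesis using Suc.IH(2)[of u] that by simp
  qed
  have step: "?E (Suc k) v \<in> ?V \<and>
      energy \<Theta> \<Omega> (?E (Suc k) v) v \<le> mg_rate C0 g0 (m (Suc k)) * energy \<Theta> \<Omega> v v"
    if "Suc k \<le> J" "v \<in> ?V" for v
    unfolding E_Suc
    using that Suc.IH(1) contraction setting_nested[of k "Suc k"]
      fem_mesh.fem_subspace[OF setting_mesh[of k]]
    by (intro conjI vcycle_step[OF setting_subspace_correction, of "Suc k" _ ?U "?E k"] ssc_smoother_eq) auto
  case 1 then show ?case using step by blast
  case 2 then show ?case using step by auto
qed

end

text \<open>Optimality lies in the order of quantifiers: \<open>\<gamma>\<close> is chosen after
  \<open>M\<close> and the constants but before \<open>J\<close>.\<close>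

theorem theorem3:
  fixes \<Theta> :: "real^'n^'n" and \<Omega> :: "(real^'n) set"
    and \<sigma> h0 C\<Theta>1 C\<Theta>2 C0 g0 :: real
    and \<T> :: "nat \<Rightarrow> (real^'n) set set"
    and p m :: "nat \<Rightarrow> nat"
    and D :: "nat \<Rightarrow> nat \<Rightarrow> (real^'n) set"
  shows
    "(\<forall>J\<ge>1. multigrid_setting \<Theta> \<Omega> \<sigma> h0 \<T> p D m C\<Theta>1 C\<Theta>2 C0 g0 J \<and> antimono_on {1..J} m \<longrightarrow>
        (\<forall>k\<in>{1..J}. mg_rate C0 g0 (m k) < 1 \<and>
           (\<forall>v\<in>fem_space \<Omega> (\<T> k).
              energy \<Theta> \<Omega> (multigrid_error \<Theta> \<Omega> h0 \<T> p D m k v) v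
                \<le> mg_rate C0 g0 (m k) * energy \<Theta> \<Omega> v v)))
     \<and> (\<forall>M. \<exists>\<gamma><1. \<forall>J\<ge>1.
          multigrid_setting \<Theta> \<Omega> \<sigma> h0 \<T> p D m C\<Theta>1 C\<Theta>2 C0 g0 J \<and> (\<forall>k\<in>{1..J}. m k = M) \<longrightarrow>
          mg_rate C0 g0 (m J) = \<gamma> \<and>
          (\<forall>v\<in>fem_space \<Omega> (\<T> J).
             energy \<Theta> \<Omega> (multigrid_error \<Theta> \<Omega> h0 \<T> p D m J v) v \<le> \<gamma> * energy \<Theta> \<Omega> v v))"
proof -
  have main: "mg_rate C0 g0 (m k) < 1 \<and> (\<forall>v\<in>fem_space \<Omega> (\<T> k).
      energy \<Theta> \<Omega> (multigrid_error \<Theta> \<Omega> h0 \<T> p D m k v) v \<le> mg_rate C0 g0 (m k) * energy \<Theta> \<Omega> v v)"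
    if "multigrid_setting \<Theta> \<Omega> \<sigma> h0 \<T> p D m C\<Theta>1 C\<Theta>2 C0 g0 J" "k \<in> {1..J}" for J k
    using multigrid_error_bound(2)[OF that(1), of k] mg_rate_bounds(2)[of C0 g0 "m k"]
      setting_simps(4)[OF that(1)] setting_simps(8)[OF that(1)] setting_g0_nonneg[OF that(1)] that(2)
    by auto
  have "\<exists>\<gamma><1. \<forall>J\<ge>1.
          multigrid_setting \<Theta> \<Omega> \<sigma> h0 \<T> p D m C\<Theta>1 C\<Theta>2 C0 g0 J \<and> (\<forall>k\<in>{1..J}. m k = M) \<longrightarrow>
          mg_rate C0 g0 (m J) = \<gamma> \<and>
          (\<forall>v\<in>fem_space \<Omega> (\<T> J).
             energy \<Theta> \<Omega> (multigrid_error \<Theta> \<Omega> h0 \<T> p D m J v) v \<le> \<gamma> * energy \<Theta> \<Omega> v v)" for M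
  proof (cases "mg_rate C0 g0 M < 1")
    case True
    have "m J = M" if "1 \<le> J" "\<forall>k\<in>{1..J}. m k = M" for J using that by simp
    then show ?thesis
      using True main by (intro exI[of _ "mg_rate C0 g0 M"]) (metis atLeastAtMost_iff order_refl)
  next
    case False
    \<comment> \<open>A rate of at least 1 contradicts \<open>main\<close>, so no \<open>J\<close>
      meets the premises for this \<open>M\<close>, and any value below 1 serves as
      \<open>\<gamma>\<close>.\<close>
    have "\<not> (multigrid_setting \<Theta> \<Omega> \<sigma> h0 \<T> p D m C\<Theta>1 C\<Theta>2 C0 g0 J \<and> (\<forall>k\<in>{1..J}. m k = M))"
      if "1 \<le> J" for J
      using main[of J J] that False by auto
    then show ?thesis by (intro exI[of _ "0 :: real"] conjI) (simp, blast)
  qed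
  then show ?thesis using main by blast
qed

end
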